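(* Let $E,A\in\mathbb{R}^{n\times n}$, $B\in\mathbb{R}^{n\times m}$, $C\in\mathbb{R}^{m\times n}$, and suppose that the descriptor system $E\dot x=Ax+Bu,\ y=Cx$ admits a pH representation $(J,R,Q,G,P)$ with nonsingular $Q$. Then there exist nonnegative integers $n_1,\dots,n_5,m_1$ with $n_1+n_2+n_3+n_4+n_5=n$ and $n_1+m_1+n_3=m$, nonsingular matrices $S,T\in\mathbb{R}^{n\times n}$ and an orthogonal matrix $W\in\mathbb{R}^{m\times m}$ such that, with rows and columns of size $n$ partitioned as $(n_1,n_2,n_3,n_4,n_5)$ and those of size $m$ partitioned as $(n_1,m_1,n_3)$, $$SET=\begin{bmatrix} E_{11} & 0 & 0 & 0 & 0 \\ 0 & E_{22} & 0 & 0 & 0 \\ 0 & 0 & 0 & 0 & 0 \\ 0 & 0 & 0 & 0 & 0 \\ 0 & 0 & 0 & 0 & 0 \end{bmatrix},\qquad SBW=\begin{bmatrix} B_{11} & 0 & 0 \\ 0 & 0 & 0 \\ 0 & 0 & B_{33} \\ 0 & 0 & 0 \\ 0 & 0 & 0 \end{bmatrix},$$ $$SAT=\begin{bmatrix} A_{11} & A_{12} & A_{13} & 0 & A_{15} \\ A_{21} & A_{22} & A_{23} & 0 & A_{25} \\ A_{31} & A_{32} & A_{33} & 0 & A_{35} \\ 0 & 0 & 0 & A_{44} & 0 \\ A_{51} & A_{52} & A_{53} & 0 & 0 \end{bmatrix},\qquad W^TCT=\begin{bmatrix} C_{11} & 0 & 0 & 0 & 0 \\ 0 & 0 & 0 &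 0 & 0 \\ 0 & 0 & C_{33} & 0 & 0 \end{bmatrix},$$ where $\operatorname{rank}(E_{11})=\operatorname{rank}(B_{11})=\operatorname{rank}(C_{11})=n_1$, $\operatorname{rank}(E_{22})=n_2$, $\operatorname{rank}(B_{33})=\operatorname{rank}(C_{33})=n_3$, and $\operatorname{rank}(A_{44})=n_4$.
   Context: All matrices are real; block sizes may be zero. $M\ge 0$ means $M$ is symmetric positive semidefinite. A pH (port-Hamiltonian) representation of the descriptor system $E\dot x=Ax+Bu,\ y=Cx$ (with $E,A\in\mathbb{R}^{n\times n}$, $B\in\mathbb{R}^{n\times m}$, $C\in\mathbb{R}^{m\times n}$) is a tuple of matrices $J,R,Q\in\mathbb{R}^{n\times n}$, $G,P\in\mathbb{R}^{n\times m}$ with $$A=(J-R)Q,\quad B=G-P,\quad C=(G+P)^TQ,$$ $$Q^TE=E^TQ\ge 0,\quad Q^TJQ=-(Q^TJQ)^T,\quad Q^TRQ\ge 0,\quad Q^TP=0.$$ *)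

theory Defs
  imports "Jordan_Normal_Form.DL_Rank"
begin

definition psd_mat :: "real mat \<Rightarrow> bool" where
  "psd_mat M \<longleftrightarrow> square_mat M \<and> transpose_mat M = M \<and>
     (\<forall>x \<in> carrier_vec (dim_row M). 0 \<le> x \<bullet> (M *\<^sub>v x))"

(* Not the library's orthogonal_mat, which only asks for pairwise orthogonal nonzero columns. *)
definition real_orthogonal_mat :: "real mat \<Rightarrow> bool" where
  "real_orthogonal_mat W \<longleftrightarrow> square_mat W \<and> transpose_mat W * W = 1\<^sub>m (dim_row W)"

definition pH_representation ::
  "nat \<Rightarrow> nat \<Rightarrow> real mat \<Rightarrow> real mat \<Rightarrow> real mat \<Rightarrow> real mat \<Rightarrow>
   real mat \<Rightarrow> real mat \<Rightarrow> real mat \<Rightarrow> real mat \<Rightarrow> real mat \<Rightarrow> bool" where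
  "pH_representation n m E A B C J R Q G P \<longleftrightarrow>
     J \<in> carrier_mat n n \<and> R \<in> carrier_mat n n \<and> Q \<in> carrier_mat n n \<and>
     G \<in> carrier_mat n m \<and> P \<in> carrier_mat n m \<and>
     A = (J - R) * Q \<and> B = G - P \<and> C = transpose_mat (G + P) * Q \<and>
     transpose_mat Q * E = transpose_mat E * Q \<and> psd_mat (transpose_mat Q * E) \<and>
     transpose_mat Q * J * Q = - transpose_mat (transpose_mat Q * J * Q) \<and>
     psd_mat (transpose_mat Q * R * Q) \<and>
     transpose_mat Q * P = 0\<^sub>m n m"

(* Dimensions, possibly zero, are read off the blocks; the empty-list value is only a default. *)
fun hcat_mats :: "'a::zero mat list \<Rightarrow> 'a mat" where
  "hcat_mats [] = 0\<^sub>m 0 0"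
| "hcat_mats [M] = M"
| "hcat_mats (M # N # Ms) =
     (let K = hcat_mats (N # Ms)
      in four_block_mat M K (0\<^sub>m 0 (dim_col M)) (0\<^sub>m 0 (dim_col K)))"

fun vcat_mats :: "'a::zero mat list \<Rightarrow> 'a mat" where
  "vcat_mats [] = 0\<^sub>m 0 0"
| "vcat_mats [M] = M"
| "vcat_mats (M # N # Ms) = M @\<^sub>r vcat_mats (N # Ms)"

(* The argument lists the block rows; it is only meaningful for blocks of matching dimensions. *)
definition block_mat :: "'a::zero mat list list \<Rightarrow> 'a mat" where
  "block_mat Mss = vcat_mats (map hcat_mats Mss)"

(* The library's rank takes the number of rows as an explicit parameter. *)
abbreviation mat_rank :: "real mat \<Rightarrow> nat" where
  "mat_rank M \<equiv> vec_space.rank (dim_row M) M"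

end

theory Submission
  imports Defs
begin

text \<open>
Since \<open>Q\<close> is nonsingular, \<open>P = 0\<close>; multiplying the system from the left by the transpose of \<open>Q\<close>
turns \<open>E\<close> into a positive semidefinite matrix, \<open>A\<close> into a matrix with nonpositive quadratic form, and
\<open>B\<close> into the transpose of \<open>C\<close>. Up to one last elimination, the remaining transformation is a congruence,
that is, a basis \<open>T1, ..., T5\<close> of the state space: \<open>T3, T4, T5\<close> span the kernel of \<open>E\<close> and
\<open>T4, T5\<close> its intersection with the kernel of \<open>C\<close>, split by the kernel of \<open>A\<close> restricted to it
(a kernel which dissipativity makes two-sided). The columns of \<open>W3\<close> span the image of \<open>T3\<close> under \<open>C\<close>,
the remaining states are corrected by \<open>T3\<close> so that their outputs are orthogonal to this image, and
\<open>T1, T2\<close> are chosen so that \<open>C\<close> vanishes on \<open>T2\<close> and they are orthogonal for \<open>E\<close>.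
Finally the rows and columns of \<open>A\<close> meeting its nonsingular block \<open>A44\<close> are cleared; this does not
affect \<open>E\<close>, \<open>B\<close> and \<open>C\<close>, because they vanish on \<open>T4\<close>.
\<close>

section \<open>Products of block matrices\<close>

text \<open>The empty list is excluded here and in the product rules below: its default value
  \<open>0\<^sub>m 0 0\<close> forgets the common size \<open>p\<close>.\<close>

lemma hcat_mats_carrier:
  assumes "Ms \<noteq> []" "\<forall>M\<in>set Ms. dim_row M = p"
  shows "hcat_mats Ms \<in> carrier_mat p (sum_list (map dim_col Ms))"
  using assms
proof (induction Ms rule: hcat_mats.induct)
  case (3 M N Ms)
  then show ?case by (auto simp: Let_def)
qed auto

text \<open>Regard \<open>A\<close> as a two by two block matrix whose second block row and column
  are empty; the product rule for such block matrices then applies.\<close>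

lemma mult_mat_four_block_mat_row:
  fixes A :: "'a::semiring_0 mat"
  assumes "A \<in> carrier_mat q p" "M \<in> carrier_mat p r" "K \<in> carrier_mat p s"
  shows "A * four_block_mat M K (0\<^sub>m 0 r) (0\<^sub>m 0 s)
    = four_block_mat (A * M) (A * K) (0\<^sub>m 0 r) (0\<^sub>m 0 s)"
proof -
  have "four_block_mat A (0\<^sub>m q 0) (0\<^sub>m 0 p) (0\<^sub>m 0 0) = A"
    using assms by (intro eq_matI) auto
  then show ?thesis
    using mult_four_block_mat[OF assms(1) zero_carrier_mat zero_carrier_mat zero_carrier_mat
        assms(2,3) zero_carrier_mat zero_carrier_mat, of 0 0] assms by simp
qed

lemma append_rows_mult:
  fixes A :: "'a::semiring_0 mat"
  assumes "M \<in> carrier_mat r p" "K \<in> carrier_mat s p" "A \<in> carrier_mat p q"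
  shows "(M @\<^sub>r K) * A = (M * A) @\<^sub>r (K * A)"
proof -
  have A: "four_block_mat A (0\<^sub>m p 0) (0\<^sub>m 0 q) (0\<^sub>m 0 0) = A"
    using assms by (intro eq_matI) auto
  show ?thesis unfolding append_rows_def
    using mult_four_block_mat[OF assms(1) zero_carrier_mat assms(2) zero_carrier_mat
        assms(3) zero_carrier_mat zero_carrier_mat zero_carrier_mat, of 0 0] assms
    by (simp add: A)
qed

lemma mult_hcat_mats:
  fixes A :: "'a::semiring_0 mat"
  assumes "Ms \<noteq> []" "\<forall>M\<in>set Ms. dim_row M = p" "A \<in> carrier_mat q p"
  shows "A * hcat_mats Ms = hcat_mats (map ((*) A) Ms)"
  using assms
proof (induction Ms rule: hcat_mats.induct)
  case (3 M N Ms)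
  let ?K = "hcat_mats (N # Ms)"
  let ?k = "sum_list (map dim_col (N # Ms))"
  have K: "?K \<in> carrier_mat p ?k" using 3 by (intro hcat_mats_carrier) auto
  have M: "M \<in> carrier_mat p (dim_col M)" using 3 by auto
  have "A * four_block_mat M ?K (0\<^sub>m 0 (dim_col M)) (0\<^sub>m 0 ?k)
    = four_block_mat (A * M) (A * ?K) (0\<^sub>m 0 (dim_col M)) (0\<^sub>m 0 ?k)"
    using mult_mat_four_block_mat_row[OF 3(4) M K] .
  moreover have "A * ?K = hcat_mats (map ((*) A) (N # Ms))" using 3 by simp
  moreover have "dim_col (A * ?K) = ?k" using K by simp
  ultimately show ?case using K by (simp add: Let_def)
qed auto

lemma transpose_hcat_mats:
  assumes "\<forall>M\<in>set Ms. dim_row M = p"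
  shows "transpose_mat (hcat_mats Ms) = vcat_mats (map transpose_mat Ms)"
  using assms
proof (induction Ms rule: hcat_mats.induct)
  case (3 M N Ms)
  let ?K = "hcat_mats (N # Ms)"
  let ?k = "sum_list (map dim_col (N # Ms))"
  have K: "?K \<in> carrier_mat p ?k" using 3 by (intro hcat_mats_carrier) auto
  have M: "M \<in> carrier_mat p (dim_col M)" using 3 by auto
  have "transpose_mat (four_block_mat M ?K (0\<^sub>m 0 (dim_col M)) (0\<^sub>m 0 ?k))
    = transpose_mat M @\<^sub>r transpose_mat ?K"
    unfolding append_rows_def transpose_four_block_mat[OF M K zero_carrier_mat zero_carrier_mat]
    using carrier_matD(2)[OF K] by simp
  moreover have "transpose_mat ?K = vcat_mats (map transpose_mat (N # Ms))"
    using 3 by simp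
  ultimately show ?case using carrier_matD(2)[OF K] by (simp add: Let_def)
qed auto

lemma vcat_mats_carrier:
  assumes "Ms \<noteq> []" "\<forall>M\<in>set Ms. dim_col M = p"
  shows "vcat_mats Ms \<in> carrier_mat (sum_list (map dim_row Ms)) p"
  using assms
proof (induction Ms rule: vcat_mats.induct)
  case (3 M N Ms)
  have "M @\<^sub>r vcat_mats (N # Ms) \<in> carrier_mat (dim_row M + sum_list (map dim_row (N # Ms))) p"
    using 3 by (intro carrier_append_rows) auto
  then show ?case by simp
qed auto

lemma vcat_mats_mult:
  fixes A :: "'a::semiring_0 mat"
  assumes "Ms \<noteq> []" "\<forall>M\<in>set Ms. dim_col M = p" "A \<in> carrier_mat p q"
  shows "vcat_mats Ms * A = vcat_mats (map (\<lambda>M. M * A) Ms)"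
  using assms
proof (induction Ms rule: vcat_mats.induct)
  case (3 M N Ms)
  let ?K = "vcat_mats (N # Ms)"
  let ?k = "sum_list (map dim_row (N # Ms))"
  have K: "?K \<in> carrier_mat ?k p" using 3 by (intro vcat_mats_carrier) auto
  have M: "M \<in> carrier_mat (dim_row M) p" using 3 by auto
  have "(M @\<^sub>r ?K) * A = (M * A) @\<^sub>r (?K * A)"
    using append_rows_mult[OF M K 3(4)] .
  then show ?case using 3 K by simp
qed auto

text \<open>The passage from bases to block matrices: when the transformations are given as
  concatenated column blocks, each block of the transformed matrix is a triple product that can be
  computed on its own.\<close>

lemma block_mat_hcat_mats:
  fixes M :: "'a::comm_semiring_1 mat"
  assumes "Ss \<noteq> []" "\<forall>S\<in>set Ss. dim_row S = p" and "Ts \<noteq> []" "\<forall>T\<in>set Ts. dim_row T = q"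
    and M: "M \<in> carrier_mat p q"
  shows "transpose_mat (hcat_mats Ss) * M * hcat_mats Ts
    = block_mat (map (\<lambda>S. map (\<lambda>T. transpose_mat S * M * T) Ts) Ss)"
proof -
  have H: "hcat_mats Ts \<in> carrier_mat q (sum_list (map dim_col Ts))"
    using assms by (intro hcat_mats_carrier) auto
  have "transpose_mat (hcat_mats Ss) * M * hcat_mats Ts
    = vcat_mats (map transpose_mat Ss) * M * hcat_mats Ts"
    by (simp add: transpose_hcat_mats[OF assms(2)])
  also have "vcat_mats (map transpose_mat Ss) * M = vcat_mats (map (\<lambda>S. transpose_mat S * M) Ss)"
    using assms vcat_mats_mult[of "map transpose_mat Ss" p M q] by (simp add: o_def)
  also have "\<dots> * hcat_mats Ts = vcat_mats (map (\<lambda>S. transpose_mat S * M * hcat_mats Ts) Ss)"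
    using assms H vcat_mats_mult[OF _ _ H, of "map (\<lambda>S. transpose_mat S * M) Ss"]
    by (simp add: o_def)
  also have "\<dots> = block_mat (map (\<lambda>S. map (\<lambda>T. transpose_mat S * M * T) Ts) Ss)"
    unfolding block_mat_def map_map o_def
  proof (intro arg_cong[where f=vcat_mats] map_cong refl)
    fix S assume "S \<in> set Ss"
    then have "transpose_mat S * M \<in> carrier_mat (dim_col S) q" using assms by auto
    then show "transpose_mat S * M * hcat_mats Ts = hcat_mats (map (\<lambda>T. transpose_mat S * M * T) Ts)"
      using mult_hcat_mats[OF assms(3,4)] by blast
  qed
  finally show ?thesis .
qed

lemma hcat_mats_Cons:
  assumes "Ms \<noteq> []"
  shows "hcat_mats (M # Ms) = four_block_mat M (hcat_mats Ms)
    (0\<^sub>m 0 (dim_col M)) (0\<^sub>m 0 (dim_col (hcat_mats Ms)))"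
  using assms by (cases Ms) (auto simp: Let_def)

lemma hcat_mats_zero:
  fixes Ms :: "'a::zero mat list"
  assumes "Ms \<noteq> []"
  shows "hcat_mats (map (\<lambda>N. 0\<^sub>m k (dim_col N)) Ms) = (0\<^sub>m k (sum_list (map dim_col Ms)) :: 'a mat)"
  using assms
proof (induction Ms rule: hcat_mats.induct)
  case (3 M N Ms)
  then show ?case by (auto simp: Let_def)
qed auto

lemma mult_hcat_mats_zero:
  fixes L :: "'a::semiring_0 mat"
  assumes "Ms \<noteq> []" "\<forall>N\<in>set Ms. dim_row N = p" and L: "L \<in> carrier_mat k p"
    and 0: "\<forall>N\<in>set Ms. L * N = 0\<^sub>m k (dim_col N)"
  shows "L * hcat_mats Ms = 0\<^sub>m k (sum_list (map dim_col Ms))"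
proof -
  have "L * hcat_mats Ms = hcat_mats (map ((*) L) Ms)"
    using mult_hcat_mats[OF assms(1,2) L] .
  also have "map ((*) L) Ms = map (\<lambda>N. 0\<^sub>m k (dim_col N)) Ms" using 0 by simp
  finally show ?thesis using hcat_mats_zero[OF assms(1)] by simp
qed

section \<open>Matrices with trivial kernel\<close>

text \<open>Full column rank, phrased through the kernel so that it passes to products and factors
  without counting ranks. For square matrices it is nonsingularity, and a matrix without columns
  satisfies it.\<close>

definition inj_mat :: "'a::semiring_0 mat \<Rightarrow> bool" where
  "inj_mat M \<longleftrightarrow> (\<forall>x \<in> carrier_vec (dim_col M). M *\<^sub>v x = 0\<^sub>v (dim_row M) \<longrightarrow> x = 0\<^sub>v (dim_col M))"

lemma inj_matI:
  assumes "M \<in> carrier_mat p q"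
    and "\<And>x. x \<in> carrier_vec q \<Longrightarrow> M *\<^sub>v x = 0\<^sub>v p \<Longrightarrow> x = 0\<^sub>v q"
  shows "inj_mat M"
  using assms by (auto simp: inj_mat_def)

lemma inj_matD:
  assumes "inj_mat M" "M \<in> carrier_mat p q" "x \<in> carrier_vec q" "M *\<^sub>v x = 0\<^sub>v p"
  shows "x = 0\<^sub>v q"
  using assms by (auto simp: inj_mat_def)

lemma mult_mat_vec_zero:
  fixes M :: "'a::semiring_0 mat"
  assumes "M \<in> carrier_mat p q"
  shows "M *\<^sub>v 0\<^sub>v q = 0\<^sub>v p"
  using assms by (intro eq_vecI) auto

lemma zero_mat_mult_vec:
  fixes x :: "'a::semiring_0 vec"
  assumes "x \<in> carrier_vec q"
  shows "0\<^sub>m p q *\<^sub>v x = 0\<^sub>v p"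
  using assms by (intro eq_vecI) auto

text \<open>Applied below with \<open>L * M\<close> an identity matrix: a left inverse forces a
  trivial kernel.\<close>

lemma inj_mat_mult_right:
  fixes M :: "'a::semiring_0 mat"
  assumes "inj_mat (L * M)" "L \<in> carrier_mat p q" "M \<in> carrier_mat q r"
  shows "inj_mat M"
proof (rule inj_matI[OF assms(3)])
  fix x assume x: "x \<in> carrier_vec r" "M *\<^sub>v x = 0\<^sub>v q"
  have "(L * M) *\<^sub>v x = 0\<^sub>v p"
    using assms x by (simp add: assoc_mult_mat_vec[where ?n\<^sub>1=p and ?n\<^sub>2=q and ?n\<^sub>3=r] mult_mat_vec_zero[OF assms(2)])
  then show "x = 0\<^sub>v r" using inj_matD[OF assms(1) mult_carrier_mat[OF assms(2,3)] x(1)] by simp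
qed

lemma inj_mat_mult:
  fixes M :: "'a::semiring_0 mat"
  assumes "inj_mat L" "inj_mat M" "L \<in> carrier_mat p q" "M \<in> carrier_mat q r"
  shows "inj_mat (L * M)"
proof (rule inj_matI[where p=p])
  fix x assume x: "x \<in> carrier_vec r" "(L * M) *\<^sub>v x = 0\<^sub>v p"
  have "L *\<^sub>v (M *\<^sub>v x) = 0\<^sub>v p"
    using assms x by (simp add: assoc_mult_mat_vec[where ?n\<^sub>1=p and ?n\<^sub>2=q and ?n\<^sub>3=r])
  then have "M *\<^sub>v x = 0\<^sub>v q" using inj_matD[OF assms(1,3)] assms x by simp
  then show "x = 0\<^sub>v r" using inj_matD[OF assms(2,4)] x by simp
qed (use assms in auto)

lemma inj_mat_one: "inj_mat (1\<^sub>m n :: 'a::semiring_1 mat)"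
  by (rule inj_matI[where p=n]) auto

text \<open>This dimension count makes the construction of orthonormal bases stop and determines the
  sizes of the square blocks of outputs.\<close>

lemma inj_mat_dim_le:
  fixes M :: "'a::field mat"
  assumes "inj_mat M" and M: "M \<in> carrier_mat p q"
  shows "q \<le> p"
proof (rule ccontr)
  assume "\<not> q \<le> p"
  define c where "c i = (if i < p then row M i else 0\<^sub>v q)" for i
  \<comment> \<open>Pad \<open>M\<close> with zero rows to a singular square matrix.\<close>
  define A where "A = mat\<^sub>r q q (\<lambda>i. if i = p then 0\<^sub>v q else c i)"
  have A: "A \<in> carrier_mat q q" by (simp add: A_def)
  have "det A = 0" unfolding A_def
    using \<open>\<not> q \<le> p\<close> M by (intro det_row_0) (auto simp: c_def)
  then obtain v where v: "v \<in> carrier_vec q" "v \<noteq> 0\<^sub>v q" "A *\<^sub>v v = 0\<^sub>v q"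
    using det_0_iff_vec_prod_zero_field[OF A] by blast
  have "M *\<^sub>v v = 0\<^sub>v p"
  proof (rule eq_vecI)
    fix i assume "i < dim_vec (0\<^sub>v p :: 'a vec)"
    then have i: "i < p" by simp
    then have "row A i = row M i"
      using \<open>\<not> q \<le> p\<close> M by (simp add: A_def c_def)
    moreover have "row A i \<bullet> v = (A *\<^sub>v v) $ i" using i \<open>\<not> q \<le> p\<close> A by simp
    then have "row A i \<bullet> v = 0" unfolding v(3) using i \<open>\<not> q \<le> p\<close> by simp
    ultimately show "(M *\<^sub>v v) $ i = 0\<^sub>v p $ i" using i M by simp
  qed (use M in auto)
  then show False using inj_matD[OF assms(1) M v(1)] v(2) by simp
qed

lemma inj_mat_square_det:
  fixes M :: "'a::field mat"
  assumes "inj_mat M" "M \<in> carrier_mat n n"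
  shows "det M \<noteq> 0"
  using assms det_0_iff_vec_prod_zero_field[OF assms(2)] inj_matD by blast

lemma inj_mat_inverse:
  fixes M :: "'a::field mat"
  assumes "inj_mat M" "M \<in> carrier_mat n n"
  obtains N where "N \<in> carrier_mat n n" "M * N = 1\<^sub>m n" "N * M = 1\<^sub>m n"
proof -
  obtain N where "N \<in> carrier_mat n n" "N * M = 1\<^sub>m n" "M * N = 1\<^sub>m n"
    using det_non_zero_imp_unit[OF assms(2) inj_mat_square_det[OF assms], of "()"]
    by (auto simp: Units_def ring_mat_def)
  then show ?thesis using that by blast
qed

lemma inj_mat_invertible:
  fixes M :: "'a::field mat"
  assumes "inj_mat M" "M \<in> carrier_mat n n"
  shows "invertible_mat M"
proof -
  obtain N where "N \<in> carrier_mat n n" "M * N = 1\<^sub>m n" "N * M = 1\<^sub>m n"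
    using inj_mat_inverse[OF assms] .
  then show ?thesis using assms by (auto simp: invertible_mat_def inverts_mat_def)
qed

text \<open>A right inverse of \<open>M\<close> transposes to a left inverse of its
  transpose.\<close>

lemma inj_mat_transpose:
  fixes M :: "'a::field mat"
  assumes "inj_mat M" and M: "M \<in> carrier_mat n n"
  shows "inj_mat (transpose_mat M)"
proof -
  obtain N where N: "N \<in> carrier_mat n n" "M * N = 1\<^sub>m n"
    using inj_mat_inverse[OF assms] .
  then have "transpose_mat N * transpose_mat M = 1\<^sub>m n"
    using transpose_mult[OF M N(1)] by simp
  then show ?thesis
    using inj_mat_one[of n] inj_mat_mult_right[of "transpose_mat N" "transpose_mat M" n n n] M N by simp
qed

lemma inj_mat_rank:
  assumes "inj_mat M" "M \<in> carrier_mat n n"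
  shows "mat_rank M = n"
proof -
  have "vec_space.rank n M = n"
    using vec_space.det_rank_iff[OF assms(2)] inj_mat_square_det[OF assms] by blast
  then show ?thesis using carrier_matD(1)[OF assms(2)] by simp
qed

text \<open>\<open>L\<close> serves as a test matrix. It kills all later blocks, so applying it to a
  vanishing combination of columns isolates the coefficients of \<open>M\<close>, and the
  injectivity of \<open>L * M\<close> makes these zero. Repeated use gives a block triangular
  independence argument.\<close>

lemma inj_hcat_mats_Cons:
  fixes M :: "'a::ring_1 mat"
  assumes "Ms \<noteq> []" "\<forall>N\<in>set Ms. dim_row N = p" and M: "M \<in> carrier_mat p q"
    and L: "L \<in> carrier_mat k p" "inj_mat (L * M)" "\<forall>N\<in>set Ms. L * N = 0\<^sub>m k (dim_col N)"
    and inj: "inj_mat (hcat_mats Ms)"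
  shows "inj_mat (hcat_mats (M # Ms))"
proof -
  define K where "K = hcat_mats Ms"
  define r where "r = sum_list (map dim_col Ms)"
  have K: "K \<in> carrier_mat p r" unfolding K_def r_def using assms by (intro hcat_mats_carrier)
  have eq: "hcat_mats (M # Ms) = four_block_mat M K (0\<^sub>m 0 q) (0\<^sub>m 0 r)"
    using hcat_mats_Cons[OF assms(1)] carrier_matD(2)[OF M] carrier_matD(2)[OF K] by (simp add: K_def)
  have LK0: "L * K = 0\<^sub>m k r"
    unfolding K_def r_def using mult_hcat_mats_zero[OF assms(1,2) L(1,3)] .
  show ?thesis unfolding eq
  proof (rule inj_matI)
    show "four_block_mat M K (0\<^sub>m 0 q) (0\<^sub>m 0 r) \<in> carrier_mat (p + 0) (q + r)"
      using M K by (intro four_block_carrier_mat) auto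
    fix x :: "'a vec" assume x: "x \<in> carrier_vec (q + r)"
      and 0: "four_block_mat M K (0\<^sub>m 0 q) (0\<^sub>m 0 r) *\<^sub>v x = 0\<^sub>v (p + 0)"
    define a b where "a = vec_first x q" and "b = vec_last x r"
    have a: "a \<in> carrier_vec q" and b: "b \<in> carrier_vec r" by (auto simp: a_def b_def)
    have x_eq: "x = a @\<^sub>v b" using x by (simp add: a_def b_def)
    have "(M *\<^sub>v a + K *\<^sub>v b) @\<^sub>v (0\<^sub>m 0 q *\<^sub>v a + 0\<^sub>m 0 r *\<^sub>v b) = 0\<^sub>v p @\<^sub>v 0\<^sub>v 0"
      using 0 four_block_mat_mult_vec[OF M K, where C="0\<^sub>m 0 q" and D="0\<^sub>m 0 r" and ?nr2.0=0] a b x_eq by auto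
    then have sum: "M *\<^sub>v a + K *\<^sub>v b = 0\<^sub>v p"
      using M K a b append_vec_eq[of "M *\<^sub>v a + K *\<^sub>v b" p "0\<^sub>v p"] by auto
    have "(L * M) *\<^sub>v a = (L * M) *\<^sub>v a + (L * K) *\<^sub>v b"
      using L M a b by (simp add: LK0 zero_mat_mult_vec)
    also have "\<dots> = L *\<^sub>v (M *\<^sub>v a + K *\<^sub>v b)"
      using L M K a b by (simp add: mult_add_distrib_mat_vec[where nr=k and nc=p])
    also have "\<dots> = 0\<^sub>v k" using sum L by (simp add: mult_mat_vec_zero)
    finally have a0: "a = 0\<^sub>v q" using inj_matD[OF L(2) mult_carrier_mat[OF L(1) M] a] by simp
    then have "K *\<^sub>v b = 0\<^sub>v p" using sum M K b by (simp add: mult_mat_vec_zero)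
    then have "b = 0\<^sub>v r" using inj_matD[OF _ K b] inj by (simp add: K_def)
    then show "x = 0\<^sub>v (q + r)" using a0 x_eq by auto
  qed
qed

section \<open>Orthonormal kernel splittings\<close>

text \<open>Rectangular matrices are allowed, so that an orthogonal matrix can be assembled from
  column blocks.\<close>

definition orthonormal_cols :: "real mat \<Rightarrow> bool" where
  "orthonormal_cols X \<longleftrightarrow> transpose_mat X * X = 1\<^sub>m (dim_col X)"

lemma orthonormal_cols_inj:
  assumes "orthonormal_cols X" "X \<in> carrier_mat p q"
  shows "inj_mat X"
proof (rule inj_mat_mult_right)
  show "inj_mat (transpose_mat X * X)"
    using assms(1) inj_mat_one by (simp add: orthonormal_cols_def)
  show "transpose_mat X \<in> carrier_mat q p" "X \<in> carrier_mat p q" using assms(2) by auto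
qed

lemma orthonormal_cols_mult:
  assumes "orthonormal_cols X" "orthonormal_cols Y" and X: "X \<in> carrier_mat p q" and Y: "Y \<in> carrier_mat q r"
  shows "orthonormal_cols (X * Y)"
proof -
  have XT: "transpose_mat X \<in> carrier_mat q p" and YT: "transpose_mat Y \<in> carrier_mat r q"
    using X Y by auto
  have "transpose_mat (X * Y) * (X * Y) = transpose_mat Y * (transpose_mat X * (X * Y))"
    unfolding transpose_mult[OF X Y] using assoc_mult_mat[OF YT XT mult_carrier_mat[OF X Y]] .
  also have "transpose_mat X * (X * Y) = 1\<^sub>m q * Y"
    using assoc_mult_mat[OF XT X Y] assms(1) X by (simp add: orthonormal_cols_def)
  also have "transpose_mat Y * \<dots> = 1\<^sub>m r" using assms Y by (simp add: orthonormal_cols_def)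
  finally show ?thesis using Y by (simp add: orthonormal_cols_def)
qed

text \<open>The Gram matrix of the concatenation is block diagonal with identity blocks.\<close>

lemma orthonormal_cols_hcat_mats_Cons:
  assumes "Ms \<noteq> []" "\<forall>N\<in>set Ms. dim_row N = p" and X: "X \<in> carrier_mat p q"
    and o: "orthonormal_cols X" "orthonormal_cols (hcat_mats Ms)"
    and 0: "\<forall>N\<in>set Ms. transpose_mat X * N = 0\<^sub>m q (dim_col N)"
  shows "orthonormal_cols (hcat_mats (X # Ms))"
proof -
  define K where "K = hcat_mats Ms"
  define r where "r = sum_list (map dim_col Ms)"
  have K: "K \<in> carrier_mat p r" unfolding K_def r_def using assms by (intro hcat_mats_carrier)
  have eq: "hcat_mats (X # Ms) = four_block_mat X K (0\<^sub>m 0 q) (0\<^sub>m 0 r)"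
    using hcat_mats_Cons[OF assms(1)] carrier_matD(2)[OF X] carrier_matD(2)[OF K] by (simp add: K_def)
  have XK: "transpose_mat X * K = 0\<^sub>m q r"
    unfolding K_def r_def using mult_hcat_mats_zero[OF assms(1,2) _ 0] X by simp
  have KX: "transpose_mat K * X = 0\<^sub>m r q"
    using transpose_mult[of "transpose_mat X" q p K r] X K XK by simp
  have XX: "transpose_mat X * X = 1\<^sub>m q" using o(1) X by (simp add: orthonormal_cols_def)
  have KK: "transpose_mat K * K = 1\<^sub>m r" using o(2) carrier_matD(2)[OF K] by (simp add: orthonormal_cols_def K_def)
  have "transpose_mat (four_block_mat X K (0\<^sub>m 0 q) (0\<^sub>m 0 r)) * four_block_mat X K (0\<^sub>m 0 q) (0\<^sub>m 0 r)
    = four_block_mat (transpose_mat X) (0\<^sub>m q 0) (transpose_mat K) (0\<^sub>m r 0) *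
      four_block_mat X K (0\<^sub>m 0 q) (0\<^sub>m 0 r)"
    by (simp add: transpose_four_block_mat[OF X K zero_carrier_mat zero_carrier_mat])
  also have "\<dots> = four_block_mat (transpose_mat X * X + 0\<^sub>m q 0 * 0\<^sub>m 0 q) (transpose_mat X * K + 0\<^sub>m q 0 * 0\<^sub>m 0 r)
      (transpose_mat K * X + 0\<^sub>m r 0 * 0\<^sub>m 0 q) (transpose_mat K * K + 0\<^sub>m r 0 * 0\<^sub>m 0 r)"
    using X K by (intro mult_four_block_mat[where ?n1.0=p and ?n2.0=0]) auto
  also have "\<dots> = 1\<^sub>m (q + r)" by (simp add: XX XK KX KK)
  finally show ?thesis using X K by (simp add: orthonormal_cols_def eq)
qed

lemma orthonormal_cols_hcat_mats_pair:
  assumes "X \<in> carrier_mat p q" "Y \<in> carrier_mat p r"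
    and "orthonormal_cols X" "orthonormal_cols Y" "transpose_mat X * Y = 0\<^sub>m q r"
  shows "orthonormal_cols (hcat_mats [X, Y])" "hcat_mats [X, Y] \<in> carrier_mat p (q + r)"
  using orthonormal_cols_hcat_mats_Cons[of "[Y]" p X q] hcat_mats_carrier[of "[X, Y]" p] assms by simp_all

text \<open>Because \<open>r + s = q\<close>, the columns of \<open>X\<close> and \<open>Y\<close>
  together form an orthonormal basis, and \<open>Y\<close> spans the orthogonal complement of the
  span of \<open>X\<close>.\<close>

definition orthonormal_split :: "nat \<Rightarrow> nat \<Rightarrow> nat \<Rightarrow> real mat \<Rightarrow> real mat \<Rightarrow> bool" where
  "orthonormal_split q r s X Y \<longleftrightarrow> r + s = q \<and> X \<in> carrier_mat q r \<and> Y \<in> carrier_mat q s \<and>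
     orthonormal_cols X \<and> orthonormal_cols Y \<and> transpose_mat X * Y = 0\<^sub>m r s"

lemma orthonormal_splitD:
  assumes "orthonormal_split q r s X Y"
  shows "X \<in> carrier_mat q r" "Y \<in> carrier_mat q s" "orthonormal_cols X" "orthonormal_cols Y"
    "transpose_mat X * Y = 0\<^sub>m r s" "r + s = q"
  using assms unfolding orthonormal_split_def by blast+

lemma transpose_hcat_mats_vec_zero:
  fixes X Y :: "'a::comm_ring_1 mat"
  assumes X: "X \<in> carrier_mat p q" and Y: "Y \<in> carrier_mat p r" and v: "v \<in> carrier_vec p"
  shows "transpose_mat (hcat_mats [X, Y]) *\<^sub>v v = 0\<^sub>v (q + r) \<longleftrightarrow>
    transpose_mat X *\<^sub>v v = 0\<^sub>v q \<and> transpose_mat Y *\<^sub>v v = 0\<^sub>v r"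
proof -
  have XT: "transpose_mat X \<in> carrier_mat q p" and YT: "transpose_mat Y \<in> carrier_mat r p"
    using X Y by auto
  have "transpose_mat (hcat_mats [X, Y]) = transpose_mat X @\<^sub>r transpose_mat Y"
    using transpose_hcat_mats[of "[X, Y]" p] X Y by simp
  then have "transpose_mat (hcat_mats [X, Y]) *\<^sub>v v = (transpose_mat X *\<^sub>v v) @\<^sub>v (transpose_mat Y *\<^sub>v v)"
    using mat_mult_append[OF XT YT v] by simp
  moreover have "(0\<^sub>v (q + r) :: 'a vec) = 0\<^sub>v q @\<^sub>v 0\<^sub>v r" by auto
  ultimately show ?thesis
    using append_vec_eq[OF mult_mat_vec_carrier[OF XT v] zero_carrier_vec] by simp
qed

text \<open>The two blocks form a square matrix which is injective by orthonormality. Its transpose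
  is then injective too, so only the zero vector is orthogonal to all basis vectors.\<close>

lemma orthonormal_split_complete:
  assumes s: "orthonormal_split q r s X Y" and v: "v \<in> carrier_vec q"
    and "transpose_mat X *\<^sub>v v = 0\<^sub>v r" "transpose_mat Y *\<^sub>v v = 0\<^sub>v s"
  shows "v = 0\<^sub>v q"
proof -
  let ?H = "hcat_mats [X, Y]"
  note D = orthonormal_splitD[OF s]
  note H = orthonormal_cols_hcat_mats_pair[OF D(1-5), unfolded D(6)]
  have "inj_mat (transpose_mat ?H)"
    using inj_mat_transpose[OF orthonormal_cols_inj[OF H] H(2)] .
  moreover have "transpose_mat ?H *\<^sub>v v = 0\<^sub>v q"
    using transpose_hcat_mats_vec_zero[OF D(1,2) v] assms(3,4) D(6) by simp
  moreover have "transpose_mat ?H \<in> carrier_mat q q" using H(2) by simp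
  ultimately show ?thesis using inj_matD v by blast
qed

section \<open>Orthonormal bases built one vector at a time\<close>

lemma scalar_prod_self_ge_0: "0 \<le> v \<bullet> (v :: real vec)"
  by (auto simp: scalar_prod_def intro: sum_nonneg)

lemma scalar_prod_self_eq_0:
  assumes "v \<in> carrier_vec n"
  shows "v \<bullet> (v :: real vec) = 0 \<longleftrightarrow> v = 0\<^sub>v n"
proof -
  have "conjugate v = v" by (intro eq_vecI) auto
  then show ?thesis using conjugate_square_eq_0_vec[OF assms] by simp
qed

text \<open>The vector \<open>v\<close> becomes a unit column. The clause about \<open>L\<close>
  carries every homogeneous linear condition from \<open>v\<close> to that column, which covers both
  orthogonality to earlier columns and membership in a kernel.\<close>

lemma normalized_col:
  assumes v: "v \<in> carrier_vec n" "v \<noteq> 0\<^sub>v n"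
  obtains U where "U \<in> carrier_mat n 1" "orthonormal_cols U"
    "\<And>L k. L \<in> carrier_mat k n \<Longrightarrow> L *\<^sub>v v = 0\<^sub>v k \<Longrightarrow> L * U = 0\<^sub>m k 1"
proof -
  define c where "c = 1 / sqrt (v \<bullet> v)"
  define U where "U = mat_of_cols n [c \<cdot>\<^sub>v v]"
  have U: "U \<in> carrier_mat n 1" by (auto simp: U_def)
  have colU: "col U 0 = c \<cdot>\<^sub>v v" using v unfolding U_def by (subst col_mat_of_cols) auto
  have pos: "v \<bullet> v > 0"
    using scalar_prod_self_ge_0[of v] scalar_prod_self_eq_0[OF v(1)] v(2) by linarith
  have "col U 0 \<bullet> col U 0 = c * c * (v \<bullet> v)"
    unfolding colU using v(1) by simp
  also have "\<dots> = 1" using pos by (simp add: c_def)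
  finally have "orthonormal_cols U"
    unfolding orthonormal_cols_def using U by (intro eq_matI) auto
  moreover have "L * U = 0\<^sub>m k 1" if L: "L \<in> carrier_mat k n" "L *\<^sub>v v = 0\<^sub>v k" for L k
  proof (rule eq_matI)
    fix i j assume ij: "i < dim_row (0\<^sub>m k 1 :: real mat)" "j < dim_col (0\<^sub>m k 1 :: real mat)"
    then have "(L * U) $$ (i, j) = row L i \<bullet> col U 0" using L U by simp
    also have "\<dots> = c * (row L i \<bullet> v)" unfolding colU using L v ij by simp
    also have "row L i \<bullet> v = (L *\<^sub>v v) $ i" using L(1) ij by simp
    also have "\<dots> = 0" unfolding L(2) using ij by simp
    finally show "(L * U) $$ (i, j) = 0\<^sub>m k 1 $$ (i, j)" using ij by simp
  qed (use L U in auto)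
  ultimately show ?thesis using that U by blast
qed

text \<open>\<open>X\<close> stays fixed while \<open>Y\<close> grows by one unit vector orthogonal
  to all present columns, until there are \<open>q\<close> columns in total.\<close>

lemma orthonormal_split_extend_aux:
  assumes "X \<in> carrier_mat q k" "Y \<in> carrier_mat q l" "orthonormal_cols X" "orthonormal_cols Y"
    "transpose_mat X * Y = 0\<^sub>m k l"
  shows "\<exists>Y' s. orthonormal_split q k s X Y'"
  using assms
proof (induction "q - (k + l)" arbitrary: Y l rule: less_induct)
  case less
  note X = less.prems(1) and Y = less.prems(2)
  note oH = orthonormal_cols_hcat_mats_pair(1)[OF less.prems]
    and H = orthonormal_cols_hcat_mats_pair(2)[OF less.prems]
  then have le: "k + l \<le> q" using inj_mat_dim_le[OF orthonormal_cols_inj[OF _ H] H] by simp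
  show ?case
  proof (cases "k + l = q")
    case True
    then have "orthonormal_split q k l X Y" using less.prems by (simp add: orthonormal_split_def)
    then show ?thesis by blast
  next
    case False
    have HT: "transpose_mat (hcat_mats [X, Y]) \<in> carrier_mat (k + l) q" using H by simp
    \<comment> \<open>With fewer than \<open>q\<close> columns the transpose has fewer rows than
      columns, so some nonzero \<open>v\<close> is orthogonal to all of them.\<close>
    have "\<not> inj_mat (transpose_mat (hcat_mats [X, Y]))"
      using inj_mat_dim_le[OF _ HT] le False by auto
    then obtain v where v: "v \<in> carrier_vec q" "v \<noteq> 0\<^sub>v q"
      "transpose_mat (hcat_mats [X, Y]) *\<^sub>v v = 0\<^sub>v (k + l)"
      using inj_matI[OF HT] by blast
    then have Xv: "transpose_mat X *\<^sub>v v = 0\<^sub>v k" and Yv: "transpose_mat Y *\<^sub>v v = 0\<^sub>v l"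
      using transpose_hcat_mats_vec_zero[OF X Y v(1)] by auto
    obtain U where U: "U \<in> carrier_mat q 1" "orthonormal_cols U"
      and LU: "\<And>L k. L \<in> carrier_mat k q \<Longrightarrow> L *\<^sub>v v = 0\<^sub>v k \<Longrightarrow> L * U = 0\<^sub>m k 1"
      using normalized_col[OF v(1,2)] by blast
    have XU: "transpose_mat X * U = 0\<^sub>m k 1" using LU[OF _ Xv] X by simp
    have YU: "transpose_mat Y * U = 0\<^sub>m l 1" using LU[OF _ Yv] Y by simp
    note orthonormal_cols_hcat_mats_pair[OF Y U(1) less.prems(4) U(2) YU]
    moreover have "transpose_mat X * hcat_mats [Y, U] = 0\<^sub>m k (l + 1)"
      using mult_hcat_mats_zero[of "[Y, U]" q "transpose_mat X" k] U XU less.prems by simp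
    ultimately show ?thesis
      using less.hyps[of "l + 1" "hcat_mats [Y, U]"] less.prems le False by auto
  qed
qed

lemma orthonormal_split_extend:
  assumes "X \<in> carrier_mat q k" "orthonormal_cols X"
  obtains Y s where "orthonormal_split q k s X Y"
proof -
  have "orthonormal_cols (0\<^sub>m q 0)" by (auto simp: orthonormal_cols_def)
  moreover have "transpose_mat X * 0\<^sub>m q 0 = 0\<^sub>m k 0" using assms by simp
  ultimately show ?thesis
    using orthonormal_split_extend_aux[OF assms(1), of "0\<^sub>m q 0" 0] assms(2) that by auto
qed

lemma orthonormal_split_commute:
  assumes "orthonormal_split q r s X Y"
  shows "orthonormal_split q s r Y X"
proof -
  note D = orthonormal_splitD[OF assms]
  have "transpose_mat Y * X = transpose_mat (transpose_mat X * Y)"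
    using transpose_mult[of "transpose_mat X" r q Y s] D by simp
  then show ?thesis using D by (simp add: orthonormal_split_def)
qed

section \<open>Splitting a space along the kernel of a matrix\<close>

text \<open>\<open>Y\<close> holds orthonormal vectors of the kernel and \<open>X\<close> completes
  it to a basis. If \<open>M\<close> is not injective on the span of \<open>X\<close>, that span
  contains a kernel vector, which is orthogonal to \<open>Y\<close> and is added to it after
  normalization.\<close>

lemma orthonormal_kernel_split_aux:
  assumes M: "M \<in> carrier_mat p q" and "Y \<in> carrier_mat q l" "orthonormal_cols Y" "M * Y = 0\<^sub>m p l"
  shows "\<exists>X Y' r s. orthonormal_split q r s X Y' \<and> M * Y' = 0\<^sub>m p s \<and> inj_mat (M * X)"
  using assms(2-)
proof (induction "q - l" arbitrary: Y l rule: less_induct)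
  case less
  note Y = less.prems(1)
  obtain X k where s: "orthonormal_split q l k Y X"
    using orthonormal_split_extend[OF Y less.prems(2)] .
  note X = orthonormal_splitD(2)[OF s] and oX = orthonormal_splitD(4)[OF s]
    and YX = orthonormal_splitD(5)[OF s] and dim = orthonormal_splitD(6)[OF s]
  show ?case
  proof (cases "inj_mat (M * X)")
    case True
    then show ?thesis using orthonormal_split_commute[OF s] less.prems(3) by blast
  next
    case False
    have MX: "M * X \<in> carrier_mat p k" using M X by simp
    obtain x where x: "x \<in> carrier_vec k" "x \<noteq> 0\<^sub>v k" "(M * X) *\<^sub>v x = 0\<^sub>v p"
      using False inj_matI[OF MX] by blast
    \<comment> \<open>\<open>k\<close> equals the induction measure \<open>q - l\<close>, which must
      be positive for a further column to decrease it.\<close>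
    have "k \<noteq> 0" using x by auto
    have v: "X *\<^sub>v x \<in> carrier_vec q" using X x by simp
    have v0: "X *\<^sub>v x \<noteq> 0\<^sub>v q"
      using inj_matD[OF orthonormal_cols_inj[OF oX X] X x(1)] x(2) by blast
    have "transpose_mat Y *\<^sub>v (X *\<^sub>v x) = (transpose_mat Y * X) *\<^sub>v x"
      using assoc_mult_mat_vec[of "transpose_mat Y" l q X k x] Y X x by simp
    then have Yv: "transpose_mat Y *\<^sub>v (X *\<^sub>v x) = 0\<^sub>v l" using YX zero_mat_mult_vec[OF x(1)] by simp
    have Mv: "M *\<^sub>v (X *\<^sub>v x) = 0\<^sub>v p" using assoc_mult_mat_vec[OF M X x(1)] x by simp
    obtain U where U: "U \<in> carrier_mat q 1" "orthonormal_cols U"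
      and LU: "\<And>L k. L \<in> carrier_mat k q \<Longrightarrow> L *\<^sub>v (X *\<^sub>v x) = 0\<^sub>v k \<Longrightarrow> L * U = 0\<^sub>m k 1"
      using normalized_col[OF v v0] by blast
    have MU: "M * U = 0\<^sub>m p 1" using LU[OF M Mv] .
    have YU: "transpose_mat Y * U = 0\<^sub>m l 1" using LU[OF _ Yv] Y by simp
    note orthonormal_cols_hcat_mats_pair[OF Y U(1) less.prems(2) U(2) YU]
    moreover have "M * hcat_mats [Y, U] = 0\<^sub>m p (l + 1)"
      using mult_hcat_mats_zero[of "[Y, U]" q M p] U MU M less.prems by simp
    ultimately show ?thesis
      using less.hyps[of "l + 1" "hcat_mats [Y, U]"] dim \<open>k \<noteq> 0\<close> by auto
  qed
qed

text \<open>\<open>Y\<close> spans the whole kernel of \<open>M\<close>, since \<open>M\<close> is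
  injective on the complement spanned by \<open>X\<close>. The construction starts from no columns
  at all.\<close>

lemma orthonormal_kernel_split:
  assumes M: "M \<in> carrier_mat p q"
  obtains X Y r s where "orthonormal_split q r s X Y" "M * Y = 0\<^sub>m p s" "inj_mat (M * X)"
proof -
  have "orthonormal_cols (0\<^sub>m q 0)" by (auto simp: orthonormal_cols_def)
  moreover have "M * 0\<^sub>m q 0 = 0\<^sub>m p 0" using M by simp
  ultimately show ?thesis
    using orthonormal_kernel_split_aux[OF M, of "0\<^sub>m q 0" 0] that by auto
qed

text \<open>This makes \<open>M * X\<close> square. Injectivity of \<open>M * X\<close> gives
  \<open>r \<le> p\<close>. Conversely, if the transpose of \<open>M * X\<close> kills
  \<open>z\<close>, then the transpose of \<open>M\<close> sends \<open>z\<close> to a vector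
  orthogonal to \<open>X\<close>, and also to \<open>Y\<close> because \<open>M * Y = 0\<close>;
  hence \<open>z = 0\<close>, and \<open>p \<le> r\<close> follows.\<close>

lemma orthonormal_kernel_split_full_row_rank:
  assumes M: "M \<in> carrier_mat p q" and inj: "inj_mat (transpose_mat M)"
  obtains X Y s where "orthonormal_split q p s X Y" "M * Y = 0\<^sub>m p s" "inj_mat (M * X)"
proof -
  obtain X Y r s where split: "orthonormal_split q r s X Y"
    and MY: "M * Y = 0\<^sub>m p s" and MX: "inj_mat (M * X)"
    using orthonormal_kernel_split[OF M] .
  note XY = orthonormal_splitD(1,2)[OF split]
  have "r \<le> p" using inj_mat_dim_le[OF MX] M XY by simp
  have MXT: "transpose_mat (M * X) = transpose_mat X * transpose_mat M"
    using transpose_mult[OF M XY(1)] .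
  have c: "transpose_mat (M * X) \<in> carrier_mat r p" using M XY by simp
  have "inj_mat (transpose_mat (M * X))"
  proof (rule inj_matI[OF c])
    fix z assume z: "z \<in> carrier_vec p" "transpose_mat (M * X) *\<^sub>v z = 0\<^sub>v r"
    define w where "w = transpose_mat M *\<^sub>v z"
    have w: "w \<in> carrier_vec q" using M z by (auto simp: w_def intro: mult_mat_vec_carrier)
    have "transpose_mat X *\<^sub>v w = 0\<^sub>v r"
      using z M XY(1) assoc_mult_mat_vec[of "transpose_mat X" r q "transpose_mat M" p z]
      unfolding w_def MXT by simp
    moreover have "transpose_mat Y *\<^sub>v w = (transpose_mat (M * Y)) *\<^sub>v z"
      using z M XY(2) assoc_mult_mat_vec[of "transpose_mat Y" s q "transpose_mat M" p z]
      unfolding w_def transpose_mult[OF M XY(2)] by simp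
    moreover have "\<dots> = 0\<^sub>v s" unfolding MY using zero_mat_mult_vec[OF z(1)] by simp
    ultimately have "w = 0\<^sub>v q" using orthonormal_split_complete[OF split w] by simp
    then show "z = 0\<^sub>v p" using inj_matD[OF inj transpose_carrier_mat[THEN iffD2, OF M] z(1)] by (simp add: w_def)
  qed
  then have "p \<le> r" using inj_mat_dim_le[OF _ c] by simp
  with \<open>r \<le> p\<close> have "r = p" by simp
  then show ?thesis using that split MY MX by blast
qed

section \<open>Semidefinite forms and elimination\<close>

text \<open>A zero of a nonnegative form is a minimum, so the gradient vanishes there. For symmetric
  \<open>M\<close> this places \<open>x\<close> in the kernel; for general \<open>M\<close> it shows
  that kernel vectors of \<open>M\<close> are also kernel vectors of its transpose.\<close>

lemma nonneg_form_kernel: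
  fixes M :: "real mat"
  assumes M: "M \<in> carrier_mat n n" and nonneg: "\<And>x. x \<in> carrier_vec n \<Longrightarrow> 0 \<le> x \<bullet> (M *\<^sub>v x)"
    and x: "x \<in> carrier_vec n" "x \<bullet> (M *\<^sub>v x) = 0"
  shows "M *\<^sub>v x + transpose_mat M *\<^sub>v x = 0\<^sub>v n"
proof -
  define w where "w = M *\<^sub>v x + transpose_mat M *\<^sub>v x"
  have w: "w \<in> carrier_vec n" using M x by (simp add: w_def)
  define a b where "a = w \<bullet> w" and "b = w \<bullet> (M *\<^sub>v w)"
  have "b \<ge> 0" unfolding b_def using nonneg w by blast
  \<comment> \<open>The form vanishes to first order along its zero \<open>x\<close>; here it is varied in the direction of its gradient.\<close>
  have nonneg_t: "0 \<le> t * a + t^2 * b" for t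
  proof -
    have "M *\<^sub>v (x + t \<cdot>\<^sub>v w) = M *\<^sub>v x + t \<cdot>\<^sub>v (M *\<^sub>v w)"
      using M x w by (simp add: mult_add_distrib_mat_vec[OF M] mult_mat_vec[OF M])
    then have "(x + t \<cdot>\<^sub>v w) \<bullet> (M *\<^sub>v (x + t \<cdot>\<^sub>v w))
      = x \<bullet> (M *\<^sub>v x) + t * (x \<bullet> (M *\<^sub>v w)) + (t * (w \<bullet> (M *\<^sub>v x)) + t * (t * (w \<bullet> (M *\<^sub>v w))))"
      using M x w by (simp add: scalar_prod_add_distrib[of _ n] add_scalar_prod_distrib[of _ n] distrib_left)
    also have "x \<bullet> (M *\<^sub>v w) = w \<bullet> (transpose_mat M *\<^sub>v x)"
      using transpose_vec_mult_scalar[OF M w x(1)] M x w by (simp add: comm_scalar_prod[of w n])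
    finally have "(x + t \<cdot>\<^sub>v w) \<bullet> (M *\<^sub>v (x + t \<cdot>\<^sub>v w))
      = t * (w \<bullet> (M *\<^sub>v x) + w \<bullet> (transpose_mat M *\<^sub>v x)) + t^2 * b"
      using x(2) by (simp add: b_def power2_eq_square algebra_simps)
    also have "w \<bullet> (M *\<^sub>v x) + w \<bullet> (transpose_mat M *\<^sub>v x) = a"
      unfolding a_def using M x w by (subst (4) w_def) (simp add: scalar_prod_add_distrib[of _ n])
    finally show ?thesis using nonneg[of "x + t \<cdot>\<^sub>v w"] x w by simp
  qed
  \<comment> \<open>The parameter is chosen negative enough to expose the linear term;
    \<open>b + 1\<close> instead of \<open>b\<close> keeps the denominator positive even if
    \<open>b = 0\<close>.\<close>
  have eq: "(- a / (b + 1)) * a + (- a / (b + 1))^2 * b = - (a^2) / (b + 1)^2"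
  proof -
    have "b + 1 \<noteq> 0" using \<open>b \<ge> 0\<close> by linarith
    then show ?thesis by (simp add: divide_simps power2_eq_square) (simp add: algebra_simps)
  qed
  have "0 \<le> - (a^2) / (b + 1)^2" using nonneg_t[of "- a / (b + 1)"] unfolding eq .
  moreover have "(b + 1)^2 > 0" using \<open>b \<ge> 0\<close> by simp
  ultimately have "a^2 \<le> 0" by (simp add: divide_le_0_iff)
  then have "a = 0" by simp
  then show ?thesis using scalar_prod_self_eq_0[OF w] by (simp add: a_def w_def)
qed

section \<open>Triple products and block elimination\<close>

lemma mult_mat_zero_right3:
  fixes M :: "'a::semiring_0 mat"
  assumes "X \<in> carrier_mat p q" "M \<in> carrier_mat q r" "Y \<in> carrier_mat r s" "M * Y = 0\<^sub>m q s"
  shows "X * M * Y = 0\<^sub>m p s"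
  using assoc_mult_mat[OF assms(1-3)] assms by simp

lemma transpose_mult3:
  fixes M :: "'a::comm_semiring_0 mat"
  assumes "X \<in> carrier_mat p q" "M \<in> carrier_mat p r" "Y \<in> carrier_mat r s"
  shows "transpose_mat (transpose_mat X * M * Y) = transpose_mat Y * transpose_mat M * X"
proof -
  have XT: "transpose_mat X \<in> carrier_mat q p" and YT: "transpose_mat Y \<in> carrier_mat s r"
    and MT: "transpose_mat M \<in> carrier_mat r p"
    using assms by auto
  have "transpose_mat (transpose_mat X * M * Y) = transpose_mat Y * (transpose_mat M * X)"
    using transpose_mult[OF mult_carrier_mat[OF XT assms(2)] assms(3)] transpose_mult[OF XT assms(2)]
    by simp
  then show ?thesis using assoc_mult_mat[OF YT MT assms(1)] by simp
qed

text \<open>\<open>L * T\<close> is square and nonsingular, so \<open>Z\<close> can be taken as its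
  inverse applied to \<open>L * F\<close>. The same elimination is used three times: to remove the
  \<open>W3\<close> component of outputs, to make \<open>T1\<close> orthogonal to \<open>T2\<close>
  for \<open>E\<close>, and to clear the blocks beside \<open>A44\<close>.\<close>

lemma inj_mat_eliminate:
  fixes L :: "'a::field mat"
  assumes L: "L \<in> carrier_mat p q" and T: "T \<in> carrier_mat q p" and F: "F \<in> carrier_mat q r"
    and inj: "inj_mat (L * T)"
  obtains Z where "Z \<in> carrier_mat p r" "L * (F - T * Z) = 0\<^sub>m p r"
proof -
  have LT: "L * T \<in> carrier_mat p p" and LF: "L * F \<in> carrier_mat p r" using L T F by auto
  obtain N where N: "N \<in> carrier_mat p p" "(L * T) * N = 1\<^sub>m p"
    using inj_mat_inverse[OF inj LT] .
  define Z where "Z = N * (L * F)"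
  have Z: "Z \<in> carrier_mat p r" using N LF by (simp add: Z_def)
  have "L * (T * Z) = (L * T) * Z" using assoc_mult_mat[OF L T Z] by simp
  also have "\<dots> = (L * T) * N * (L * F)" unfolding Z_def using assoc_mult_mat[OF LT N(1) LF] by simp
  also have "\<dots> = L * F" unfolding N(2) using left_mult_one_mat[OF LF] .
  finally have "L * (F - T * Z) = L * F - L * F"
    using mult_minus_distrib_mat[OF L F mult_carrier_mat[OF T Z]] by simp
  then show ?thesis using that Z minus_r_inv_mat[OF LF] by simp
qed

text \<open>The companion of elimination: a correction by columns of \<open>K\<close> is invisible
  to every matrix that vanishes on \<open>K\<close>.\<close>

lemma mult_minus_annihilated:
  fixes M :: "'a::ring mat"
  assumes M: "M \<in> carrier_mat p q" and F: "F \<in> carrier_mat q r" and K: "K \<in> carrier_mat q s"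
    and Z: "Z \<in> carrier_mat s r" and "M * K = 0\<^sub>m p s"
  shows "M * (F - K * Z) = M * F"
proof -
  have "M * (K * Z) = 0\<^sub>m p r" using assoc_mult_mat[OF M K Z] assms(5) Z by simp
  then have "M * (F - K * Z) = M * F - 0\<^sub>m p r"
    using mult_minus_distrib_mat[OF M F mult_carrier_mat[OF K Z]] by simp
  then show ?thesis using M F by (intro eq_matI) auto
qed

section \<open>Restrictions of semidefinite forms\<close>

text \<open>If the compressed matrix kills \<open>x\<close>, then \<open>y = X x\<close> is a zero
  of the form of \<open>E\<close>. Semidefiniteness turns this into \<open>E y = 0\<close>, and
  injectivity of \<open>E * X\<close> gives \<open>x = 0\<close>.\<close>

lemma inj_mat_nonneg_form:
  fixes E X :: "real mat"
  assumes E: "E \<in> carrier_mat n n" and sym: "transpose_mat E = E"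
    and nonneg: "\<And>x. x \<in> carrier_vec n \<Longrightarrow> 0 \<le> x \<bullet> (E *\<^sub>v x)"
    and X: "X \<in> carrier_mat n k" and inj: "inj_mat (E * X)"
  shows "inj_mat (transpose_mat X * E * X)"
proof -
  have XT: "transpose_mat X \<in> carrier_mat k n" using X by simp
  have c: "transpose_mat X * E * X \<in> carrier_mat k k" using X E by simp
  show ?thesis
  proof (rule inj_matI[OF c])
    fix x :: "real vec" assume x: "x \<in> carrier_vec k" and 0: "transpose_mat X * E * X *\<^sub>v x = 0\<^sub>v k"
    define y where "y = X *\<^sub>v x"
    have y: "y \<in> carrier_vec n" using X x by (simp add: y_def)
    have Ey: "E *\<^sub>v y \<in> carrier_vec n" using E y by simp
    have eq: "transpose_mat X * E * X *\<^sub>v x = transpose_mat X *\<^sub>v (E *\<^sub>v y)"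
      unfolding y_def
      using assoc_mult_mat_vec[OF mult_carrier_mat[OF XT E] X x] assoc_mult_mat_vec[OF XT E y]
      by (simp add: y_def)
    have "y \<bullet> (E *\<^sub>v y) = (E *\<^sub>v y) \<bullet> y" using comm_scalar_prod[OF y Ey] .
    also have "\<dots> = (transpose_mat X *\<^sub>v (E *\<^sub>v y)) \<bullet> x"
      using transpose_vec_mult_scalar[OF X x Ey] by (simp add: y_def)
    also have "\<dots> = 0" unfolding eq[symmetric] 0 using x by simp
    finally have "E *\<^sub>v y + E *\<^sub>v y = 0\<^sub>v n"
      using nonneg_form_kernel[OF E nonneg y] sym by simp
    then have "E *\<^sub>v y = 0\<^sub>v n"
      using Ey by (auto simp: vec_eq_iff)
    then have "(E * X) *\<^sub>v x = 0\<^sub>v n" using assoc_mult_mat_vec[OF E X x] by (simp add: y_def)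
    then show "x = 0\<^sub>v k" using inj_matD[OF inj mult_carrier_mat[OF E X] x] by simp
  qed
qed

lemma nonpos_form_kernel:
  fixes M :: "real mat"
  assumes M: "M \<in> carrier_mat n n" and nonpos: "\<And>x. x \<in> carrier_vec n \<Longrightarrow> x \<bullet> (M *\<^sub>v x) \<le> 0"
    and x: "x \<in> carrier_vec n" "x \<bullet> (M *\<^sub>v x) = 0"
  shows "M *\<^sub>v x + transpose_mat M *\<^sub>v x = 0\<^sub>v n"
proof -
  have neg: "- M *\<^sub>v y = - (M *\<^sub>v y)" "transpose_mat (- M) *\<^sub>v y = - (transpose_mat M *\<^sub>v y)"
    if "y \<in> carrier_vec n" for y
    using that M by (auto simp: transpose_uminus)
  have c: "M *\<^sub>v x \<in> carrier_vec n" "transpose_mat M *\<^sub>v x \<in> carrier_vec n"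
    using M x by auto
  have "y \<bullet> (- M *\<^sub>v y) = - (y \<bullet> (M *\<^sub>v y))" if "y \<in> carrier_vec n" for y
    using that M by (simp add: neg)
  then have "- M *\<^sub>v x + transpose_mat (- M) *\<^sub>v x = 0\<^sub>v n"
    using nonpos M x by (intro nonneg_form_kernel) auto
  then have "- (M *\<^sub>v x) + - (transpose_mat M *\<^sub>v x) = 0\<^sub>v n" unfolding neg[OF x(1)] .
  moreover have "u + v = 0\<^sub>v n" if "- u + - v = 0\<^sub>v n" "u \<in> carrier_vec n" "v \<in> carrier_vec n"
    for u v :: "real vec"
    using that by (auto simp: vec_eq_iff)
  ultimately show ?thesis using c by blast
qed

text \<open>A kernel vector of \<open>M\<close> is a zero of its form and hence also lies in the
  kernel of the transpose. So the image of \<open>M\<close> is orthogonal to \<open>Y\<close>, and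
  if its component along \<open>X\<close> vanishes as well, the image vector is zero. This is why
  the compression of \<open>M\<close> to \<open>X\<close> is nonsingular although \<open>M\<close>
  is not assumed symmetric.\<close>

lemma nonpos_form_split:
  fixes M :: "real mat"
  assumes M: "M \<in> carrier_mat n n" and nonpos: "\<And>x. x \<in> carrier_vec n \<Longrightarrow> x \<bullet> (M *\<^sub>v x) \<le> 0"
  obtains X Y r s where "orthonormal_split n r s X Y" "M * Y = 0\<^sub>m n s" "transpose_mat Y * M = 0\<^sub>m s n"
    "inj_mat (transpose_mat X * M * X)"
proof -
  obtain X Y r s where split: "orthonormal_split n r s X Y"
    and MY: "M * Y = 0\<^sub>m n s" and MX: "inj_mat (M * X)"
    using orthonormal_kernel_split[OF M] .
  note X = orthonormal_splitD(1)[OF split] and Y = orthonormal_splitD(2)[OF split]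
  have XT: "transpose_mat X \<in> carrier_mat r n" and YT: "transpose_mat Y \<in> carrier_mat s n"
    and MT: "transpose_mat M \<in> carrier_mat n n"
    using X Y M by auto
  have MTY: "transpose_mat M * Y = 0\<^sub>m n s"
  proof (rule eq_matI)
    fix i j assume ij: "i < dim_row (0\<^sub>m n s :: real mat)" "j < dim_col (0\<^sub>m n s :: real mat)"
    have y: "col Y j \<in> carrier_vec n" using Y ij by auto
    have "M *\<^sub>v col Y j = col (M * Y) j" using col_mult2[OF M Y] ij by simp
    then have My: "M *\<^sub>v col Y j = 0\<^sub>v n" using ij by (simp add: MY)
    then have "transpose_mat M *\<^sub>v col Y j = 0\<^sub>v n"
      using nonpos_form_kernel[OF M nonpos y] y MT by simp
    then have "(transpose_mat M *\<^sub>v col Y j) $ i = 0" using ij by simp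
    then show "(transpose_mat M * Y) $$ (i, j) = 0\<^sub>m n s $$ (i, j)" using M Y ij by simp
  qed (use M Y in auto)
  have YM: "transpose_mat Y * M = 0\<^sub>m s n"
    using transpose_mult[OF MT Y] by (simp add: MTY)
  have c: "transpose_mat X * M * X \<in> carrier_mat r r" using X M by simp
  have "inj_mat (transpose_mat X * M * X)"
  proof (rule inj_matI[OF c])
    fix x :: "real vec" assume x: "x \<in> carrier_vec r" and 0: "transpose_mat X * M * X *\<^sub>v x = 0\<^sub>v r"
    define w where "w = M *\<^sub>v (X *\<^sub>v x)"
    have Xx: "X *\<^sub>v x \<in> carrier_vec n" using X x by simp
    have w: "w \<in> carrier_vec n" using M Xx by (simp add: w_def)
    have "transpose_mat X *\<^sub>v w = 0\<^sub>v r"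
      unfolding w_def using 0 assoc_mult_mat_vec[OF mult_carrier_mat[OF XT M] X x] assoc_mult_mat_vec[OF XT M Xx]
      by simp
    moreover have "transpose_mat Y *\<^sub>v w = 0\<^sub>v s"
      unfolding w_def using assoc_mult_mat_vec[OF YT M Xx] zero_mat_mult_vec[OF Xx] by (simp add: YM)
    ultimately have "w = 0\<^sub>v n" using orthonormal_split_complete[OF split w] by blast
    then have "(M * X) *\<^sub>v x = 0\<^sub>v n" using assoc_mult_mat_vec[OF M X x] by (simp add: w_def)
    then show "x = 0\<^sub>v r" using inj_matD[OF MX mult_carrier_mat[OF M X] x] by simp
  qed
  then show ?thesis using that split MY YM by blast
qed

section \<open>Condensed bases\<close>

text \<open>Two successive kernel splits. \<open>H\<close> and \<open>K\<close> together span the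
  kernel of \<open>E\<close>; within it, \<open>K\<close> spans the kernel of \<open>C\<close>, and
  \<open>F\<close> spans a complement of the kernel of \<open>E\<close>.\<close>

lemma kernel_decomposition:
  assumes E: "E \<in> carrier_mat p n" and C: "C \<in> carrier_mat m n"
  obtains F H K r h k where "r + h + k = n"
    "F \<in> carrier_mat n r" "H \<in> carrier_mat n h" "K \<in> carrier_mat n k"
    "E * H = 0\<^sub>m p h" "E * K = 0\<^sub>m p k" "inj_mat (E * F)"
    "C * K = 0\<^sub>m m k" "inj_mat (C * H)" "orthonormal_cols K"
proof -
  obtain F N r s where FN: "orthonormal_split n r s F N" "E * N = 0\<^sub>m p s" "inj_mat (E * F)"
    using orthonormal_kernel_split[OF E] .
  note F = orthonormal_splitD(1)[OF FN(1)] and N = orthonormal_splitD(2)[OF FN(1)]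
  obtain X Z h k where XZ: "orthonormal_split s h k X Z" "C * N * Z = 0\<^sub>m m k" "inj_mat (C * N * X)"
    using orthonormal_kernel_split[OF mult_carrier_mat[OF C N]] .
  note X = orthonormal_splitD(1)[OF XZ(1)] and Z = orthonormal_splitD(2)[OF XZ(1)]
  show ?thesis
  proof (rule that)
    show "r + h + k = n" using orthonormal_splitD(6)[OF FN(1)] orthonormal_splitD(6)[OF XZ(1)] by simp
    show "F \<in> carrier_mat n r" "N * X \<in> carrier_mat n h" "N * Z \<in> carrier_mat n k"
      using F N X Z by auto
    show "E * (N * X) = 0\<^sub>m p h" using assoc_mult_mat[OF E N X] FN(2) X by simp
    show "E * (N * Z) = 0\<^sub>m p k" using assoc_mult_mat[OF E N Z] FN(2) Z by simp
    show "C * (N * Z) = 0\<^sub>m m k" using assoc_mult_mat[OF C N Z] XZ(2) by simp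
    show "inj_mat (C * (N * X))" using assoc_mult_mat[OF C N X] XZ(3) by simp
    show "orthonormal_cols (N * Z)"
      using orthonormal_cols_mult[OF orthonormal_splitD(4)[OF FN(1)] orthonormal_splitD(4)[OF XZ(1)] N Z] .
  qed (fact FN(3))
qed

text \<open>The output space is split into the image of \<open>H\<close> (columns
  \<open>W3\<close>), what the corrected remaining states contribute beyond it (\<open>W1\<close>),
  and the directions that no output reaches from either (\<open>W2\<close>). The states in turn are
  split by whether they contribute to \<open>W1\<close>.\<close>

lemma output_decomposition:
  assumes C: "C \<in> carrier_mat m n" and H: "H \<in> carrier_mat n h" and inj: "inj_mat (C * H)"
    and F: "F \<in> carrier_mat n r"
  obtains Z W1 W2 W3 Y1 Y2 n1 n2 m1 where
    "Z \<in> carrier_mat h r" "orthonormal_split r n1 n2 Y1 Y2" "n1 + m1 + h = m"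
    "W1 \<in> carrier_mat m n1" "W2 \<in> carrier_mat m m1" "W3 \<in> carrier_mat m h"
    "orthonormal_cols (hcat_mats [W1, W2, W3])"
    "transpose_mat W1 * C * H = 0\<^sub>m n1 h" "transpose_mat W2 * C * H = 0\<^sub>m m1 h"
    "inj_mat (transpose_mat W3 * C * H)"
    "transpose_mat W2 * C * (F - H * Z) = 0\<^sub>m m1 r" "transpose_mat W3 * C * (F - H * Z) = 0\<^sub>m h r"
    "inj_mat (transpose_mat W1 * C * (F - H * Z) * Y1)"
    "transpose_mat W1 * C * (F - H * Z) * Y2 = 0\<^sub>m n1 n2"
proof -
  define M where "M = transpose_mat (C * H)"
  have CH: "C * H \<in> carrier_mat m h" using C H by simp
  have M: "M \<in> carrier_mat h m" using CH by (simp add: M_def)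
  have MT: "inj_mat (transpose_mat M)" using inj by (simp add: M_def)
  \<comment> \<open>The kernel of \<open>M\<close> is the orthogonal complement of the image of
    \<open>C * H\<close>, so \<open>W3\<close> spans that image; it has \<open>h\<close> columns
    since \<open>C * H\<close> is injective.\<close>
  obtain W3 U u where W3U: "orthonormal_split m h u W3 U" "M * U = 0\<^sub>m h u" "inj_mat (M * W3)"
    using orthonormal_kernel_split_full_row_rank[OF M MT] .
  note W3 = orthonormal_splitD(1)[OF W3U(1)] and U = orthonormal_splitD(2)[OF W3U(1)]
  have W3T: "transpose_mat W3 \<in> carrier_mat h m" and UT: "transpose_mat U \<in> carrier_mat u m"
    using W3 U by auto
  have UCH: "transpose_mat U * (C * H) = 0\<^sub>m u h"
    using transpose_mult[OF M U] W3U(2) by (simp add: M_def)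
  have "transpose_mat (M * W3) = transpose_mat W3 * (C * H)"
    using transpose_mult[OF M W3] by (simp add: M_def)
  then have "inj_mat (transpose_mat W3 * (C * H))"
    using inj_mat_transpose[OF W3U(3) mult_carrier_mat[OF M W3]] by simp
  then have inj3: "inj_mat (transpose_mat W3 * C * H)"
    unfolding assoc_mult_mat[OF W3T C H] .
  \<comment> \<open>The correction by \<open>H\<close> removes the \<open>W3\<close> component from
    the outputs of \<open>F\<close>.\<close>
  obtain Z where Z: "Z \<in> carrier_mat h r" "transpose_mat W3 * C * (F - H * Z) = 0\<^sub>m h r"
    using inj_mat_eliminate[OF mult_carrier_mat[OF W3T C] H F inj3] .
  define F' where "F' = F - H * Z"
  have F': "F' \<in> carrier_mat n r" unfolding F'_def using minus_carrier_mat[OF mult_carrier_mat[OF H Z(1)]] .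
  define D where "D = C * F'"
  have D: "D \<in> carrier_mat m r" using C F' by (simp add: D_def)
  have DT: "transpose_mat D \<in> carrier_mat r m" using D by simp
  have DU: "transpose_mat D * U \<in> carrier_mat r u" using D U by simp
  \<comment> \<open>Within the span of \<open>U\<close>, the kernel of the transpose of
    \<open>D\<close> consists of the directions orthogonal to all outputs in \<open>D\<close>; it
    yields \<open>W2\<close>, and its complement yields \<open>W1\<close>.\<close>
  obtain V1 V2 n1 m1 where V: "orthonormal_split u n1 m1 V1 V2"
    "transpose_mat D * U * V2 = 0\<^sub>m r m1" "inj_mat (transpose_mat D * U * V1)"
    using orthonormal_kernel_split[OF DU] .
  note V1 = orthonormal_splitD(1)[OF V(1)] and V2 = orthonormal_splitD(2)[OF V(1)]
  define W1 where "W1 = U * V1"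
  define W2 where "W2 = U * V2"
  have W1: "W1 \<in> carrier_mat m n1" and W2: "W2 \<in> carrier_mat m m1"
    using U V1 V2 by (auto simp: W1_def W2_def)
  have W1T: "transpose_mat W1 \<in> carrier_mat n1 m" and W2T: "transpose_mat W2 \<in> carrier_mat m1 m"
    using W1 W2 by auto
  have W1eq: "transpose_mat W1 = transpose_mat V1 * transpose_mat U"
    and W2eq: "transpose_mat W2 = transpose_mat V2 * transpose_mat U"
    using transpose_mult[OF U V1] transpose_mult[OF U V2] by (simp_all add: W1_def W2_def)
  have V1T: "transpose_mat V1 \<in> carrier_mat n1 u" and V2T: "transpose_mat V2 \<in> carrier_mat m1 u"
    using V1 V2 by auto
  have W1D: "transpose_mat W1 * D = transpose_mat (transpose_mat D * U * V1)"
    using transpose_mult[OF DT W1] assoc_mult_mat[OF DT U V1] by (simp add: W1_def)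
  have "transpose_mat D * W2 = 0\<^sub>m r m1"
    using assoc_mult_mat[OF DT U V2] V(2) by (simp add: W2_def)
  then have W2D: "transpose_mat W2 * D = 0\<^sub>m m1 r"
    using transpose_mult[OF DT W2] by simp
  have W1Dc: "transpose_mat W1 * D \<in> carrier_mat n1 r" using W1T D by simp
  have W1DT: "inj_mat (transpose_mat (transpose_mat W1 * D))" using V(3) by (simp add: W1D)
  \<comment> \<open>The rows of \<open>transpose_mat W1 * D\<close> are independent, so
    \<open>Y1\<close> has exactly \<open>n1\<close> columns and the block on it is square.\<close>
  obtain Y1 Y2 n2 where Y: "orthonormal_split r n1 n2 Y1 Y2"
    "transpose_mat W1 * D * Y2 = 0\<^sub>m n1 n2" "inj_mat (transpose_mat W1 * D * Y1)"
    using orthonormal_kernel_split_full_row_rank[OF W1Dc W1DT] .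
  have VV: "transpose_mat V1 * V2 = 0\<^sub>m n1 m1" and UU: "transpose_mat U * U = 1\<^sub>m u"
    using orthonormal_splitD[OF V(1)] orthonormal_splitD(4)[OF W3U(1)] U by (auto simp: orthonormal_cols_def)
  have UW3: "transpose_mat U * W3 = 0\<^sub>m u h"
    using orthonormal_splitD(5)[OF orthonormal_split_commute[OF W3U(1)]] .
  have "transpose_mat W1 * W2 = transpose_mat V1 * (transpose_mat U * (U * V2))"
    unfolding W1eq W2_def using assoc_mult_mat[OF V1T UT mult_carrier_mat[OF U V2]] .
  also have "transpose_mat U * (U * V2) = V2"
    using assoc_mult_mat[OF UT U V2] UU V2 by simp
  finally have W12: "transpose_mat W1 * W2 = 0\<^sub>m n1 m1" using VV by simp
  have W13: "transpose_mat W1 * W3 = 0\<^sub>m n1 h" and W23: "transpose_mat W2 * W3 = 0\<^sub>m m1 h"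
    unfolding W1eq W2eq
    using assoc_mult_mat[OF V1T UT W3] assoc_mult_mat[OF V2T UT W3] UW3 V1T V2T by auto
  have oU: "orthonormal_cols U" using orthonormal_splitD(4)[OF W3U(1)] .
  have o1: "orthonormal_cols W1" and o2: "orthonormal_cols W2"
    unfolding W1_def W2_def
    using orthonormal_cols_mult[OF oU orthonormal_splitD(3)[OF V(1)] U V1]
      orthonormal_cols_mult[OF oU orthonormal_splitD(4)[OF V(1)] U V2] by auto
  have o23: "orthonormal_cols (hcat_mats [W2, W3])"
    using orthonormal_cols_hcat_mats_pair(1)[OF W2 W3 o2 orthonormal_splitD(3)[OF W3U(1)] W23] .
  have W: "orthonormal_cols (hcat_mats [W1, W2, W3])"
    using W12 W13 W1 W2 W3 by (intro orthonormal_cols_hcat_mats_Cons[OF _ _ W1 o1 o23]) auto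
  have assoc: "transpose_mat W1 * C * F' = transpose_mat W1 * D" "transpose_mat W2 * C * F' = transpose_mat W2 * D"
    unfolding D_def using assoc_mult_mat[OF W1T C F'] assoc_mult_mat[OF W2T C F'] by auto
  show ?thesis
  proof (rule that)
    show "n1 + m1 + h = m"
      using orthonormal_splitD(6)[OF W3U(1)] orthonormal_splitD(6)[OF V(1)] by simp
    show "transpose_mat W1 * C * H = 0\<^sub>m n1 h"
      using assoc_mult_mat[OF W1T C H] assoc_mult_mat[OF V1T UT CH] V1T by (simp add: W1eq UCH)
    show "transpose_mat W2 * C * H = 0\<^sub>m m1 h"
      using assoc_mult_mat[OF W2T C H] assoc_mult_mat[OF V2T UT CH] V2T by (simp add: W2eq UCH)
    show "transpose_mat W2 * C * (F - H * Z) = 0\<^sub>m m1 r"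
      using assoc(2) W2D by (simp add: F'_def)
    show "inj_mat (transpose_mat W1 * C * (F - H * Z) * Y1)"
      "transpose_mat W1 * C * (F - H * Z) * Y2 = 0\<^sub>m n1 n2"
      using assoc(1) Y by (simp_all add: F'_def)
  qed (fact Z(1) Y(1) W1 W2 W3 W inj3 Z(2))+
qed

text \<open>\<open>H\<close> serves as \<open>T3\<close>, a split of \<open>K\<close> gives
  \<open>T4\<close> and \<open>T5\<close>, and the corrected complement \<open>F'\<close> is divided
  into \<open>T1\<close> and \<open>T2\<close>. The one remaining correction, of \<open>T1\<close>
  along \<open>T2\<close>, makes these two orthogonal for \<open>E\<close> and leaves the outputs
  alone, as \<open>T2\<close> produces none.\<close>

lemma condensed_basis:
  assumes E: "E \<in> carrier_mat n n" and sym: "transpose_mat E = E"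
    and nonneg: "\<And>x. x \<in> carrier_vec n \<Longrightarrow> 0 \<le> x \<bullet> (E *\<^sub>v x)"
    and A: "A \<in> carrier_mat n n" and nonpos: "\<And>x. x \<in> carrier_vec n \<Longrightarrow> x \<bullet> (A *\<^sub>v x) \<le> 0"
    and C: "C \<in> carrier_mat m n"
  obtains n1 n2 n3 n4 n5 m1 T1 T2 T3 T4 T5 W1 W2 W3 where
    "n1 + n2 + n3 + n4 + n5 = n" "n1 + m1 + n3 = m"
    "T1 \<in> carrier_mat n n1" "T2 \<in> carrier_mat n n2" "T3 \<in> carrier_mat n n3"
    "T4 \<in> carrier_mat n n4" "T5 \<in> carrier_mat n n5"
    "W1 \<in> carrier_mat m n1" "W2 \<in> carrier_mat m m1" "W3 \<in> carrier_mat m n3"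
    "orthonormal_cols (hcat_mats [W1, W2, W3])" "inj_mat (hcat_mats [T4, T5])"
    "E * T3 = 0\<^sub>m n n3" "E * T4 = 0\<^sub>m n n4" "E * T5 = 0\<^sub>m n n5"
    "transpose_mat T1 * E * T2 = 0\<^sub>m n1 n2" "transpose_mat T2 * E * T1 = 0\<^sub>m n2 n1"
    "inj_mat (transpose_mat T1 * E * T1)" "inj_mat (transpose_mat T2 * E * T2)"
    "C * T4 = 0\<^sub>m m n4" "C * T5 = 0\<^sub>m m n5"
    "inj_mat (transpose_mat W1 * C * T1)" "transpose_mat W2 * C * T1 = 0\<^sub>m m1 n1" "transpose_mat W3 * C * T1 = 0\<^sub>m n3 n1"
    "transpose_mat W1 * C * T2 = 0\<^sub>m n1 n2" "transpose_mat W2 * C * T2 = 0\<^sub>m m1 n2" "transpose_mat W3 * C * T2 = 0\<^sub>m n3 n2"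
    "transpose_mat W1 * C * T3 = 0\<^sub>m n1 n3" "transpose_mat W2 * C * T3 = 0\<^sub>m m1 n3" "inj_mat (transpose_mat W3 * C * T3)"
    "inj_mat (transpose_mat T4 * A * T4)" "transpose_mat T4 * A * T5 = 0\<^sub>m n4 n5"
    "transpose_mat T5 * A * T4 = 0\<^sub>m n5 n4" "transpose_mat T5 * A * T5 = 0\<^sub>m n5 n5"
proof -
  obtain F H K r h k where dim: "r + h + k = n"
    and F: "F \<in> carrier_mat n r" and H: "H \<in> carrier_mat n h" and K: "K \<in> carrier_mat n k"
    and EH: "E * H = 0\<^sub>m n h" and EK: "E * K = 0\<^sub>m n k" and EF: "inj_mat (E * F)"
    and CK: "C * K = 0\<^sub>m m k" and CH: "inj_mat (C * H)" and oK: "orthonormal_cols K"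
    using kernel_decomposition[OF E C] .
  obtain Z W1 W2 W3 Y1 Y2 n1 n2 m1 where Z: "Z \<in> carrier_mat h r"
    and Y: "orthonormal_split r n1 n2 Y1 Y2" and dimm: "n1 + m1 + h = m"
    and W1: "W1 \<in> carrier_mat m n1" and W2: "W2 \<in> carrier_mat m m1" and W3: "W3 \<in> carrier_mat m h"
    and oW: "orthonormal_cols (hcat_mats [W1, W2, W3])"
    and W1H: "transpose_mat W1 * C * H = 0\<^sub>m n1 h" and W2H: "transpose_mat W2 * C * H = 0\<^sub>m m1 h"
    and W3H: "inj_mat (transpose_mat W3 * C * H)"
    and W2F: "transpose_mat W2 * C * (F - H * Z) = 0\<^sub>m m1 r" and W3F: "transpose_mat W3 * C * (F - H * Z) = 0\<^sub>m h r"
    and W1Y1: "inj_mat (transpose_mat W1 * C * (F - H * Z) * Y1)"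
    and W1Y2: "transpose_mat W1 * C * (F - H * Z) * Y2 = 0\<^sub>m n1 n2"
    using output_decomposition[OF C H CH F] .
  define F' where "F' = F - H * Z"
  note W2F = W2F[folded F'_def] and W3F = W3F[folded F'_def]
    and W1Y1 = W1Y1[folded F'_def] and W1Y2 = W1Y2[folded F'_def]
  have F': "F' \<in> carrier_mat n r" unfolding F'_def using minus_carrier_mat[OF mult_carrier_mat[OF H Z]] .
  \<comment> \<open>\<open>F\<close> was corrected only by columns in the kernel of
    \<open>E\<close>.\<close>
  have EF': "E * F' = E * F" unfolding F'_def using mult_minus_annihilated[OF E F H Z EH] .
  note Y1 = orthonormal_splitD(1)[OF Y] and Y2 = orthonormal_splitD(2)[OF Y]
    and Y12 = orthonormal_splitD(5)[OF Y]
  define T2 where "T2 = F' * Y2"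
  have T2: "T2 \<in> carrier_mat n n2" using F' Y2 by (simp add: T2_def)
  have T2T: "transpose_mat T2 \<in> carrier_mat n2 n" using T2 by simp
  have EF'c: "E * F' \<in> carrier_mat n r" using E F' by simp
  have injE: "inj_mat (E * (F' * Y))" if "inj_mat Y" "Y \<in> carrier_mat r l" for Y l
    using inj_mat_mult[OF EF[folded EF'] that(1) EF'c that(2)] assoc_mult_mat[OF E F' that(2)] by simp
  have "inj_mat (E * T2)" unfolding T2_def
    using injE[OF orthonormal_cols_inj[OF orthonormal_splitD(4)[OF Y] Y2] Y2] .
  then have E22: "inj_mat (transpose_mat T2 * E * T2)"
    using inj_mat_nonneg_form[OF E sym nonneg T2] by blast
  \<comment> \<open>A block Gram-Schmidt step for the form of \<open>E\<close>, which is nonsingular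
    on \<open>T2\<close>.\<close>
  obtain X where X: "X \<in> carrier_mat n2 n1" and E21': "transpose_mat T2 * E * (F' * Y1 - T2 * X) = 0\<^sub>m n2 n1"
    using inj_mat_eliminate[OF mult_carrier_mat[OF T2T E] T2 mult_carrier_mat[OF F' Y1] E22] .
  \<comment> \<open>Written as \<open>F' * Y1'\<close>, the block \<open>T1\<close> inherits what is
    known about \<open>F'\<close>: no outputs along \<open>W2\<close> and \<open>W3\<close>, and
    injectivity of \<open>E * F'\<close>.\<close>
  define Y1' where "Y1' = Y1 - Y2 * X"
  have Y1': "Y1' \<in> carrier_mat r n1" unfolding Y1'_def using minus_carrier_mat[OF mult_carrier_mat[OF Y2 X]] .
  define T1 where "T1 = F' * Y1'"
  have T1: "T1 \<in> carrier_mat n n1" using F' Y1' by (simp add: T1_def)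
  have T1_alt: "T1 = F' * Y1 - T2 * X"
    unfolding T1_def Y1'_def T2_def
    using mult_minus_distrib_mat[OF F' Y1 mult_carrier_mat[OF Y2 X]] assoc_mult_mat[OF F' Y2 X] by simp
  have E21: "transpose_mat T2 * E * T1 = 0\<^sub>m n2 n1" using E21' by (simp add: T1_alt)
  have E12: "transpose_mat T1 * E * T2 = 0\<^sub>m n1 n2"
    using transpose_mult3[OF T2 E T1] by (simp add: E21 sym)
  have Y1T: "transpose_mat Y1 \<in> carrier_mat n1 r" using Y1 by simp
  \<comment> \<open>The correction by \<open>Y2\<close> is orthogonal to \<open>Y1\<close>, so
    \<open>transpose_mat Y1\<close> is still a left inverse.\<close>
  have "transpose_mat Y1 * Y1' = 1\<^sub>m n1"
    unfolding Y1'_def mult_minus_annihilated[OF Y1T Y1 Y2 X Y12]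
    using orthonormal_splitD(3)[OF Y] Y1 by (simp add: orthonormal_cols_def)
  then have "inj_mat Y1'"
    by (intro inj_mat_mult_right[OF _ Y1T Y1']) (simp add: inj_mat_one)
  then have "inj_mat (E * T1)" unfolding T1_def using injE Y1' by blast
  then have E11: "inj_mat (transpose_mat T1 * E * T1)"
    using inj_mat_nonneg_form[OF E sym nonneg T1] by blast
  have W1C: "transpose_mat W1 * C \<in> carrier_mat n1 n" and W2C: "transpose_mat W2 * C \<in> carrier_mat m1 n"
    and W3C: "transpose_mat W3 * C \<in> carrier_mat h n" using W1 W2 W3 C by auto
  have W1F': "transpose_mat W1 * C * F' \<in> carrier_mat n1 r" using W1C F' by simp
  have W1T2: "transpose_mat W1 * C * T2 = 0\<^sub>m n1 n2"
    unfolding T2_def using assoc_mult_mat[OF W1C F' Y2] W1Y2 by simp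
  have "transpose_mat W1 * C * T1 = transpose_mat W1 * C * (F' * Y1)"
    unfolding T1_alt using mult_minus_annihilated[OF W1C mult_carrier_mat[OF F' Y1] T2 X W1T2] .
  then have W1T1: "inj_mat (transpose_mat W1 * C * T1)"
    using W1Y1 assoc_mult_mat[OF W1C F' Y1] by simp
  have W2_0: "transpose_mat W2 * C * (F' * Y) = 0\<^sub>m m1 l" if "Y \<in> carrier_mat r l" for Y l
    using assoc_mult_mat[OF W2C F' that] that by (simp add: W2F)
  have W3_0: "transpose_mat W3 * C * (F' * Y) = 0\<^sub>m h l" if "Y \<in> carrier_mat r l" for Y l
    using assoc_mult_mat[OF W3C F' that] that by (simp add: W3F)
  have KT: "transpose_mat K \<in> carrier_mat k n" using K by simp
  \<comment> \<open>The compression of \<open>A\<close> to the common kernel of \<open>E\<close> and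
    \<open>C\<close>; its form is that of \<open>A\<close> on vectors \<open>K x\<close>, hence
    nonpositive.\<close>
  define Ak where "Ak = transpose_mat K * A * K"
  have Ak: "Ak \<in> carrier_mat k k" using K A by (simp add: Ak_def)
  have Ak_nonpos: "x \<bullet> (Ak *\<^sub>v x) \<le> 0" if x: "x \<in> carrier_vec k" for x
  proof -
    have Kx: "K *\<^sub>v x \<in> carrier_vec n" using K x by simp
    have AKx: "A *\<^sub>v (K *\<^sub>v x) \<in> carrier_vec n" using A Kx by simp
    have "Ak *\<^sub>v x = transpose_mat K *\<^sub>v (A *\<^sub>v (K *\<^sub>v x))"
      unfolding Ak_def using assoc_mult_mat_vec[OF mult_carrier_mat[OF KT A] K x] assoc_mult_mat_vec[OF KT A Kx] by simp
    then have "x \<bullet> (Ak *\<^sub>v x) = (transpose_mat K *\<^sub>v (A *\<^sub>v (K *\<^sub>v x))) \<bullet> x"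
      using comm_scalar_prod[OF x mult_mat_vec_carrier[OF Ak x]] by simp
    also have "\<dots> = (A *\<^sub>v (K *\<^sub>v x)) \<bullet> (K *\<^sub>v x)" using transpose_vec_mult_scalar[OF K x AKx] .
    also have "\<dots> = (K *\<^sub>v x) \<bullet> (A *\<^sub>v (K *\<^sub>v x))" using comm_scalar_prod[OF AKx Kx] .
    finally show ?thesis using nonpos[OF Kx] by simp
  qed
  obtain X4 X5 n4 n5 where X45: "orthonormal_split k n4 n5 X4 X5" and AX5: "Ak * X5 = 0\<^sub>m k n5"
    and X5A: "transpose_mat X5 * Ak = 0\<^sub>m n5 k" and A44: "inj_mat (transpose_mat X4 * Ak * X4)"
    using nonpos_form_split[OF Ak Ak_nonpos] .
  note X4 = orthonormal_splitD(1)[OF X45] and X5 = orthonormal_splitD(2)[OF X45]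
  have KAK: "transpose_mat (K * X) * A * (K * Y) = transpose_mat X * Ak * Y"
    if X: "X \<in> carrier_mat k a" and Y: "Y \<in> carrier_mat k b" for X Y a b
  proof -
    have XT: "transpose_mat X \<in> carrier_mat a k" using X by simp
    have KA: "transpose_mat K * A \<in> carrier_mat k n" using KT A by simp
    have "transpose_mat (K * X) * A * (K * Y) = transpose_mat X * (transpose_mat K * A) * (K * Y)"
      unfolding transpose_mult[OF K X] assoc_mult_mat[OF XT KT A] ..
    also have "\<dots> = transpose_mat X * (transpose_mat K * A * (K * Y))"
      using assoc_mult_mat[OF XT KA mult_carrier_mat[OF K Y]] .
    also have "transpose_mat K * A * (K * Y) = Ak * Y"
      unfolding Ak_def using assoc_mult_mat[OF KA K Y] by simp
    finally show ?thesis using assoc_mult_mat[OF XT Ak Y] by simp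
  qed
  have X4T: "transpose_mat X4 \<in> carrier_mat n4 k" using X4 by simp
  have hK: "hcat_mats [K * X4, K * X5] = K * hcat_mats [X4, X5]"
    using mult_hcat_mats[of "[X4, X5]" k K n] K X4 X5 by simp
  note pair = orthonormal_cols_hcat_mats_pair[OF orthonormal_splitD(1-5)[OF X45]]
  have inj45: "inj_mat (hcat_mats [K * X4, K * X5])"
    unfolding hK using inj_mat_mult[OF orthonormal_cols_inj[OF oK K] orthonormal_cols_inj[OF pair] K]
      pair(2) orthonormal_splitD(6)[OF X45] by simp
  have kill: "M * (K * X) = 0\<^sub>m p l" if "M \<in> carrier_mat p n" "M * K = 0\<^sub>m p k" "X \<in> carrier_mat k l" for M X p l
    using assoc_mult_mat[OF that(1) K that(3)] that by simp
  show ?thesis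
  proof (rule that[where ?T1.0=T1 and ?T2.0=T2 and ?T3.0=H and ?T4.0="K * X4" and ?T5.0="K * X5"
        and ?W1.0=W1 and ?W2.0=W2 and ?W3.0=W3])
    show "n1 + n2 + h + n4 + n5 = n"
      using dim orthonormal_splitD(6)[OF Y] orthonormal_splitD(6)[OF X45] by simp
    show "K * X4 \<in> carrier_mat n n4" "K * X5 \<in> carrier_mat n n5" using K X4 X5 by auto
    show "E * (K * X4) = 0\<^sub>m n n4" "E * (K * X5) = 0\<^sub>m n n5"
      using kill[OF E EK] X4 X5 by blast+
    show "C * (K * X4) = 0\<^sub>m m n4" "C * (K * X5) = 0\<^sub>m m n5"
      using kill[OF C CK] X4 X5 by blast+
    show "transpose_mat W2 * C * T1 = 0\<^sub>m m1 n1" "transpose_mat W3 * C * T1 = 0\<^sub>m h n1"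
      unfolding T1_def using W2_0[OF Y1'] W3_0[OF Y1'] .
    show "transpose_mat W2 * C * T2 = 0\<^sub>m m1 n2" "transpose_mat W3 * C * T2 = 0\<^sub>m h n2"
      unfolding T2_def using W2_0[OF Y2] W3_0[OF Y2] .
    show "inj_mat (transpose_mat (K * X4) * A * (K * X4))" unfolding KAK[OF X4 X4] by (fact A44)
    show "transpose_mat (K * X4) * A * (K * X5) = 0\<^sub>m n4 n5"
      unfolding KAK[OF X4 X5] using mult_mat_zero_right3[OF X4T Ak X5 AX5] .
    show "transpose_mat (K * X5) * A * (K * X4) = 0\<^sub>m n5 n4"
      unfolding KAK[OF X5 X4] X5A using X4 by simp
    show "transpose_mat (K * X5) * A * (K * X5) = 0\<^sub>m n5 n5"
      unfolding KAK[OF X5 X5] X5A using X5 by simp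
  qed (fact dimm T1 T2 H W1 W2 W3 oW inj45 EH E12 E21 E11 E22 W1T1 W1T2 W1H W2H W3H)+
qed

section \<open>The condensed form\<close>

text \<open>Subtracting columns of \<open>K\<close> clears the block of \<open>A\<close> in the rows
  belonging to \<open>K\<close>, and goes unnoticed by \<open>E\<close> and \<open>C\<close>, which
  vanish on \<open>K\<close>.\<close>

lemma decouple_columns:
  fixes A :: "real mat"
  assumes A: "A \<in> carrier_mat n n" and E: "E \<in> carrier_mat p n" and C: "C \<in> carrier_mat m n"
    and K: "K \<in> carrier_mat n k" and F: "F \<in> carrier_mat n r"
    and "E * K = 0\<^sub>m p k" "C * K = 0\<^sub>m m k" and inj: "inj_mat (transpose_mat K * A * K)"
  obtains F' where "F' \<in> carrier_mat n r" "E * F' = E * F" "C * F' = C * F"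
    "transpose_mat K * A * F' = 0\<^sub>m k r"
proof -
  have KA: "transpose_mat K * A \<in> carrier_mat k n" using K A by simp
  obtain Z where Z: "Z \<in> carrier_mat k r" "transpose_mat K * A * (F - K * Z) = 0\<^sub>m k r"
    using inj_mat_eliminate[OF KA K F inj] .
  show ?thesis
    using that[of "F - K * Z"] minus_carrier_mat[OF mult_carrier_mat[OF K Z(1)]] Z(2)
      mult_minus_annihilated[OF E F K Z(1)] mult_minus_annihilated[OF C F K Z(1)] assms by blast
qed

lemma transpose_triple_zero_iff:
  fixes M :: "'a::comm_semiring_0 mat"
  assumes "X \<in> carrier_mat p q" "M \<in> carrier_mat p r" "Y \<in> carrier_mat r s"
  shows "transpose_mat Y * transpose_mat M * X = 0\<^sub>m s q \<longleftrightarrow> transpose_mat X * M * Y = 0\<^sub>m q s"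
proof
  assume "transpose_mat Y * transpose_mat M * X = 0\<^sub>m s q"
  then have "transpose_mat (transpose_mat (transpose_mat X * M * Y)) = transpose_mat (0\<^sub>m s q)"
    unfolding transpose_mult3[OF assms] by (rule arg_cong)
  then show "transpose_mat X * M * Y = 0\<^sub>m q s" unfolding transpose_transpose zero_transpose_mat .
next
  assume "transpose_mat X * M * Y = 0\<^sub>m q s"
  then show "transpose_mat Y * transpose_mat M * X = 0\<^sub>m s q"
    unfolding transpose_mult3[OF assms, symmetric] by simp
qed

lemma inj_mat_transpose3:
  fixes M :: "'a::field mat"
  assumes "X \<in> carrier_mat p q" "M \<in> carrier_mat p r" "Y \<in> carrier_mat r q"
    and inj: "inj_mat (transpose_mat X * M * Y)"
  shows "inj_mat (transpose_mat Y * transpose_mat M * X)"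
proof -
  have "transpose_mat X * M * Y \<in> carrier_mat q q" using assms by simp
  then show ?thesis
    using inj_mat_transpose[OF inj] transpose_mult3[OF assms(1-3)] by simp
qed

text \<open>The conclusion of the theorem folded into a predicate, so that it can be proved from
  dissipativity alone.\<close>

definition has_condensed_form ::
  "nat \<Rightarrow> nat \<Rightarrow> real mat \<Rightarrow> real mat \<Rightarrow> real mat \<Rightarrow> real mat \<Rightarrow> bool" where
  "has_condensed_form n m E A B C \<longleftrightarrow> (
    \<exists>(n1::nat) (n2::nat) (n3::nat) (n4::nat) (n5::nat) (m1::nat) S T W
         E11 E22 B11 B33 A11 A12 A13 A15
         A21 A22 A23 A25 A31 A32 A33 A35
         A44 A51 A52 A53 C11 C33.
      n1 + n2 + n3 + n4 + n5 = n \<and> n1 + m1 + n3 = m \<and>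
      S \<in> carrier_mat n n \<and> invertible_mat S \<and>
      T \<in> carrier_mat n n \<and> invertible_mat T \<and>
      W \<in> carrier_mat m m \<and> real_orthogonal_mat W \<and>
      E11 \<in> carrier_mat n1 n1 \<and> E22 \<in> carrier_mat n2 n2 \<and> B11 \<in> carrier_mat n1 n1 \<and>
      B33 \<in> carrier_mat n3 n3 \<and> A11 \<in> carrier_mat n1 n1 \<and> A12 \<in> carrier_mat n1 n2 \<and>
      A13 \<in> carrier_mat n1 n3 \<and> A15 \<in> carrier_mat n1 n5 \<and> A21 \<in> carrier_mat n2 n1 \<and>
      A22 \<in> carrier_mat n2 n2 \<and> A23 \<in> carrier_mat n2 n3 \<and> A25 \<in> carrier_mat n2 n5 \<and>
      A31 \<in> carrier_mat n3 n1 \<and> A32 \<in> carrier_mat n3 n2 \<and> A33 \<in> carrier_mat n3 n3 \<and>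
      A35 \<in> carrier_mat n3 n5 \<and> A44 \<in> carrier_mat n4 n4 \<and> A51 \<in> carrier_mat n5 n1 \<and>
      A52 \<in> carrier_mat n5 n2 \<and> A53 \<in> carrier_mat n5 n3 \<and> C11 \<in> carrier_mat n1 n1 \<and>
      C33 \<in> carrier_mat n3 n3 \<and>
      S * E * T = block_mat
          [[E11, 0\<^sub>m n1 n2, 0\<^sub>m n1 n3, 0\<^sub>m n1 n4, 0\<^sub>m n1 n5],
           [0\<^sub>m n2 n1, E22, 0\<^sub>m n2 n3, 0\<^sub>m n2 n4, 0\<^sub>m n2 n5],
           [0\<^sub>m n3 n1, 0\<^sub>m n3 n2, 0\<^sub>m n3 n3, 0\<^sub>m n3 n4, 0\<^sub>m n3 n5],
           [0\<^sub>m n4 n1, 0\<^sub>m n4 n2, 0\<^sub>m n4 n3, 0\<^sub>m n4 n4, 0\<^sub>m n4 n5],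
           [0\<^sub>m n5 n1, 0\<^sub>m n5 n2, 0\<^sub>m n5 n3, 0\<^sub>m n5 n4, 0\<^sub>m n5 n5]] \<and>
      S * B * W = block_mat
          [[B11, 0\<^sub>m n1 m1, 0\<^sub>m n1 n3],
           [0\<^sub>m n2 n1, 0\<^sub>m n2 m1, 0\<^sub>m n2 n3],
           [0\<^sub>m n3 n1, 0\<^sub>m n3 m1, B33],
           [0\<^sub>m n4 n1, 0\<^sub>m n4 m1, 0\<^sub>m n4 n3],
           [0\<^sub>m n5 n1, 0\<^sub>m n5 m1, 0\<^sub>m n5 n3]] \<and>
      S * A * T = block_mat
          [[A11, A12, A13, 0\<^sub>m n1 n4, A15],
           [A21, A22, A23, 0\<^sub>m n2 n4, A25],
           [A31, A32, A33, 0\<^sub>m n3 n4, A35],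
           [0\<^sub>m n4 n1, 0\<^sub>m n4 n2, 0\<^sub>m n4 n3, A44, 0\<^sub>m n4 n5],
           [A51, A52, A53, 0\<^sub>m n5 n4, 0\<^sub>m n5 n5]] \<and>
      transpose_mat W * C * T = block_mat
          [[C11, 0\<^sub>m n1 n2, 0\<^sub>m n1 n3, 0\<^sub>m n1 n4, 0\<^sub>m n1 n5],
           [0\<^sub>m m1 n1, 0\<^sub>m m1 n2, 0\<^sub>m m1 n3, 0\<^sub>m m1 n4, 0\<^sub>m m1 n5],
           [0\<^sub>m n3 n1, 0\<^sub>m n3 n2, C33, 0\<^sub>m n3 n4, 0\<^sub>m n3 n5]] \<and>
      mat_rank E11 = n1 \<and> mat_rank B11 = n1 \<and> mat_rank C11 = n1 \<and>
      mat_rank E22 = n2 \<and> mat_rank B33 = n3 \<and> mat_rank C33 = n3 \<and>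
      mat_rank A44 = n4)"

text \<open>Of the pH structure only this is retained: multiplication by the transpose of
  \<open>Q\<close> makes \<open>E\<close> symmetric with nonnegative form, makes the form of
  \<open>A\<close> nonpositive, and turns \<open>B\<close> into the transpose of \<open>C\<close>.
  Hence the input blocks are transposes of output blocks.\<close>

lemma dissipative_has_condensed_form:
  assumes E: "E \<in> carrier_mat n n" and A: "A \<in> carrier_mat n n" and B: "B \<in> carrier_mat n m"
    and C: "C \<in> carrier_mat m n" and Q: "Q \<in> carrier_mat n n" and inj: "inj_mat (transpose_mat Q)"
    and CB: "transpose_mat C = transpose_mat Q * B"
    and QE: "transpose_mat (transpose_mat Q * E) = transpose_mat Q * E"
    and nonneg: "\<And>x. x \<in> carrier_vec n \<Longrightarrow> 0 \<le> x \<bullet> (transpose_mat Q * E *\<^sub>v x)"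
    and nonpos: "\<And>x. x \<in> carrier_vec n \<Longrightarrow> x \<bullet> (transpose_mat Q * A *\<^sub>v x) \<le> 0"
  shows "has_condensed_form n m E A B C"
proof -
  define Et At where "Et = transpose_mat Q * E" and "At = transpose_mat Q * A"
  have QT: "transpose_mat Q \<in> carrier_mat n n" using Q by simp
  have Et: "Et \<in> carrier_mat n n" and At: "At \<in> carrier_mat n n"
    using Q E A by (auto simp: Et_def At_def)
  have AtT: "transpose_mat At \<in> carrier_mat n n" and CT: "transpose_mat C \<in> carrier_mat n m"
    using At C by auto
  have sym: "transpose_mat Et = Et" using QE by (simp add: Et_def)
  obtain n1 n2 n3 n4 n5 m1 T1 T2 T3 T4 T5 W1 W2 W3 where
    dims: "n1 + n2 + n3 + n4 + n5 = n" "n1 + m1 + n3 = m"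
    and T1: "T1 \<in> carrier_mat n n1" and T2: "T2 \<in> carrier_mat n n2" and T3: "T3 \<in> carrier_mat n n3"
    and T4: "T4 \<in> carrier_mat n n4" and T5: "T5 \<in> carrier_mat n n5"
    and W1: "W1 \<in> carrier_mat m n1" and W2: "W2 \<in> carrier_mat m m1" and W3: "W3 \<in> carrier_mat m n3"
    and oW: "orthonormal_cols (hcat_mats [W1, W2, W3])" and inj45: "inj_mat (hcat_mats [T4, T5])"
    and ET: "Et * T3 = 0\<^sub>m n n3" "Et * T4 = 0\<^sub>m n n4" "Et * T5 = 0\<^sub>m n n5"
    and E12: "transpose_mat T1 * Et * T2 = 0\<^sub>m n1 n2" and E21: "transpose_mat T2 * Et * T1 = 0\<^sub>m n2 n1"
    and E11: "inj_mat (transpose_mat T1 * Et * T1)" and E22: "inj_mat (transpose_mat T2 * Et * T2)"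
    and CT4: "C * T4 = 0\<^sub>m m n4" and CT5: "C * T5 = 0\<^sub>m m n5"
    and C11: "inj_mat (transpose_mat W1 * C * T1)" and C21: "transpose_mat W2 * C * T1 = 0\<^sub>m m1 n1"
    and C31: "transpose_mat W3 * C * T1 = 0\<^sub>m n3 n1" and C12: "transpose_mat W1 * C * T2 = 0\<^sub>m n1 n2"
    and C22: "transpose_mat W2 * C * T2 = 0\<^sub>m m1 n2" and C32: "transpose_mat W3 * C * T2 = 0\<^sub>m n3 n2"
    and C13: "transpose_mat W1 * C * T3 = 0\<^sub>m n1 n3" and C23: "transpose_mat W2 * C * T3 = 0\<^sub>m m1 n3"
    and C33: "inj_mat (transpose_mat W3 * C * T3)"
    and A44: "inj_mat (transpose_mat T4 * At * T4)" and A45: "transpose_mat T4 * At * T5 = 0\<^sub>m n4 n5"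
    and A54: "transpose_mat T5 * At * T4 = 0\<^sub>m n5 n4" and A55: "transpose_mat T5 * At * T5 = 0\<^sub>m n5 n5"
    using condensed_basis[OF Et sym _ At _ C] nonneg nonpos unfolding Et_def At_def by blast
  \<comment> \<open>The columns \<open>V\<close> are used for \<open>T\<close> and the columns \<open>S1, S2, S3\<close> for the rows of \<open>S\<close>: clearing the
    blocks of \<open>A\<close> beside and above \<open>A44\<close> takes different operations, as \<open>A\<close> is not symmetric.\<close>
  note decouple = decouple_columns[OF At Et C T4 _ ET(2) CT4 A44]
  obtain V1 where V1: "V1 \<in> carrier_mat n n1" "Et * V1 = Et * T1" "C * V1 = C * T1"
    "transpose_mat T4 * At * V1 = 0\<^sub>m n4 n1" using decouple[OF T1] .
  obtain V2 where V2: "V2 \<in> carrier_mat n n2" "Et * V2 = Et * T2" "C * V2 = C * T2"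
    "transpose_mat T4 * At * V2 = 0\<^sub>m n4 n2" using decouple[OF T2] .
  obtain V3 where V3: "V3 \<in> carrier_mat n n3" "Et * V3 = Et * T3" "C * V3 = C * T3"
    "transpose_mat T4 * At * V3 = 0\<^sub>m n4 n3" using decouple[OF T3] .
  \<comment> \<open>Clearing columns for the transpose of \<open>At\<close> amounts to clearing rows
    for \<open>At\<close>; the pivot is the transposed \<open>A44\<close> block.\<close>
  note decouple' = decouple_columns[OF AtT Et C T4 _ ET(2) CT4 inj_mat_transpose3[OF T4 At T4 A44]]
  obtain S1 where S1: "S1 \<in> carrier_mat n n1" "Et * S1 = Et * T1" "C * S1 = C * T1"
    "transpose_mat T4 * transpose_mat At * S1 = 0\<^sub>m n4 n1" using decouple'[OF T1] .
  obtain S2 where S2: "S2 \<in> carrier_mat n n2" "Et * S2 = Et * T2" "C * S2 = C * T2"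
    "transpose_mat T4 * transpose_mat At * S2 = 0\<^sub>m n4 n2" using decouple'[OF T2] .
  obtain S3 where S3: "S3 \<in> carrier_mat n n3" "Et * S3 = Et * T3" "C * S3 = C * T3"
    "transpose_mat T4 * transpose_mat At * S3 = 0\<^sub>m n4 n3" using decouple'[OF T3] .
  \<comment> \<open>A triple product depends on its right factor only through the image under the
    middle matrix: \<open>cong\<close> exchanges factors with equal images, and \<open>zero3\<close>
    and \<open>zero3'\<close> treat zero images on the right and on the left.\<close>
  have cong: "transpose_mat Y * M * X = transpose_mat Y * M * X'"
    if "M * X = M * X'" "M \<in> carrier_mat p n" "Y \<in> carrier_mat p k" "X \<in> carrier_mat n l" "X' \<in> carrier_mat n l"
    for M X X' Y :: "real mat" and p k l
  proof -
    have YT: "transpose_mat Y \<in> carrier_mat k p" using that by simp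
    show ?thesis unfolding assoc_mult_mat[OF YT that(2,4)] assoc_mult_mat[OF YT that(2,5)] that(1) ..
  qed
  have zero3: "transpose_mat Y * M * X = 0\<^sub>m k l"
    if "M * X = 0\<^sub>m p l" "M \<in> carrier_mat p n" "Y \<in> carrier_mat p k" "X \<in> carrier_mat n l"
    for M X Y :: "real mat" and p k l
    using mult_mat_zero_right3[of "transpose_mat Y" k p M n X l] that by simp
  have zero3': "transpose_mat X * M * Y = 0\<^sub>m l k"
    if "transpose_mat M * X = 0\<^sub>m p l" "M \<in> carrier_mat n p" "Y \<in> carrier_mat p k" "X \<in> carrier_mat n l"
    for M X Y :: "real mat" and p k l
  proof -
    have "transpose_mat X * M = 0\<^sub>m l p"
      using transpose_mult[of "transpose_mat M" p n X l] that by simp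
    then show ?thesis using that(3) by simp
  qed
  \<comment> \<open>One independence proof covers both column families. The blocks
    \<open>X3\<close>, \<open>X2\<close>, \<open>X1\<close> are added in this order and tested by
    \<open>W3\<close> through \<open>C\<close>, by \<open>T2\<close> through \<open>Et\<close>, and
    by \<open>W1\<close> through \<open>C\<close>; each test kills the blocks already
    present.\<close>
  have full: "inj_mat (hcat_mats [X1, X2, X3, T4, T5])"
    if X1: "X1 \<in> carrier_mat n n1" "C * X1 = C * T1" and X2: "X2 \<in> carrier_mat n n2" "Et * X2 = Et * T2" "C * X2 = C * T2"
      and X3: "X3 \<in> carrier_mat n n3" "Et * X3 = Et * T3" "C * X3 = C * T3"
    for X1 X2 X3
  proof -
    have W1C: "transpose_mat W1 * C \<in> carrier_mat n1 n" and W3C: "transpose_mat W3 * C \<in> carrier_mat n3 n"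
      and T2E: "transpose_mat T2 * Et \<in> carrier_mat n2 n"
      using W1 W3 C T2 Et by auto
    have i3: "inj_mat (hcat_mats [X3, T4, T5])"
      using inj_hcat_mats_Cons[of "[T4, T5]" n X3 n3, OF _ _ X3(1) W3C _ _ inj45]
        cong[OF X3(3) C W3 X3(1) T3] C33 zero3[OF CT4 C W3 T4] zero3[OF CT5 C W3 T5] T4 T5 by simp
    have i2: "inj_mat (hcat_mats [X2, X3, T4, T5])"
      using inj_hcat_mats_Cons[of "[X3, T4, T5]" n X2 n2, OF _ _ X2(1) T2E _ _ i3]
        cong[OF X2(2) Et T2 X2(1) T2] E22 zero3[OF ET(2) Et T2 T4] zero3[OF ET(3) Et T2 T5]
        cong[OF X3(2) Et T2 X3(1) T3] zero3[OF ET(1) Et T2 T3] X3(1) T4 T5 by simp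
    show ?thesis
      using inj_hcat_mats_Cons[of "[X2, X3, T4, T5]" n X1 n1, OF _ _ X1(1) W1C _ _ i2]
        cong[OF X1(2) C W1 X1(1) T1] C11 cong[OF X2(3) C W1 X2(1) T2] C12
        cong[OF X3(3) C W1 X3(1) T3] C13 zero3[OF CT4 C W1 T4] zero3[OF CT5 C W1 T5]
        X2(1) X3(1) T4 T5 by simp
  qed
  define T where "T = hcat_mats [V1, V2, V3, T4, T5]"
  define L where "L = hcat_mats [S1, S2, S3, T4, T5]"
  define W where "W = hcat_mats [W1, W2, W3]"
  \<comment> \<open>The left transformation absorbs the multiplication by the transpose of
    \<open>Q\<close>.\<close>
  define S where "S = transpose_mat L * transpose_mat Q"
  have T: "T \<in> carrier_mat n n"
    using hcat_mats_carrier[of "[V1, V2, V3, T4, T5]" n] V1(1) V2(1) V3(1) T4 T5 dims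
    by (simp add: T_def add.assoc)
  have L: "L \<in> carrier_mat n n"
    using hcat_mats_carrier[of "[S1, S2, S3, T4, T5]" n] S1(1) S2(1) S3(1) T4 T5 dims
    by (simp add: L_def add.assoc)
  have W: "W \<in> carrier_mat m m"
    using hcat_mats_carrier[of "[W1, W2, W3]" m] W1 W2 W3 dims by (simp add: W_def add.assoc)
  have LT: "transpose_mat L \<in> carrier_mat n n" using L by simp
  have S: "S \<in> carrier_mat n n" using LT QT by (simp add: S_def)
  have "inj_mat L" unfolding L_def using full S1 S2 S3 by blast
  then have "inj_mat S" unfolding S_def
    using inj_mat_mult[OF inj_mat_transpose[OF _ L] inj LT QT] by blast
  then have invS: "invertible_mat S" using inj_mat_invertible S by blast
  have "inj_mat T" unfolding T_def using full V1 V2 V3 by blast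
  then have invT: "invertible_mat T" using inj_mat_invertible T by blast
  have orthW: "real_orthogonal_mat W"
    using oW[folded W_def] W by (simp add: real_orthogonal_mat_def orthonormal_cols_def)
  have SE: "S * E * T = transpose_mat L * Et * T"
    unfolding S_def Et_def using assoc_mult_mat[OF LT QT E] by simp
  have SA: "S * A * T = transpose_mat L * At * T"
    unfolding S_def At_def using assoc_mult_mat[OF LT QT A] by simp
  have SB: "S * B * W = transpose_mat L * transpose_mat C * W"
    unfolding S_def CB using assoc_mult_mat[OF LT QT B] by simp
  have Lrows: "\<forall>M\<in>set [S1, S2, S3, T4, T5]. dim_row M = n"
    and Trows: "\<forall>M\<in>set [V1, V2, V3, T4, T5]. dim_row M = n"
    and Wrows: "\<forall>M\<in>set [W1, W2, W3]. dim_row M = m"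
    using S1(1) S2(1) S3(1) V1(1) V2(1) V3(1) T4 T5 W1 W2 W3 by auto
  have EV3: "Et * V3 = 0\<^sub>m n n3" and ES3: "Et * S3 = 0\<^sub>m n n3"
    using V3 S3 ET(1) by auto
  have ETr: "transpose_mat Et * X = 0\<^sub>m n l" if "Et * X = 0\<^sub>m n l" for X l
    using that by (simp add: sym)
  have Zr: "transpose_mat X * Et * V3 = 0\<^sub>m l n3" "transpose_mat X * Et * T4 = 0\<^sub>m l n4"
      "transpose_mat X * Et * T5 = 0\<^sub>m l n5"
      "transpose_mat S3 * Et * X = 0\<^sub>m n3 l" "transpose_mat T4 * Et * X = 0\<^sub>m n4 l"
      "transpose_mat T5 * Et * X = 0\<^sub>m n5 l"
    if "X \<in> carrier_mat n l" for X l
    using zero3[OF EV3 Et that V3(1)] zero3[OF ET(2) Et that T4] zero3[OF ET(3) Et that T5]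
      zero3'[OF ETr[OF ES3] Et that S3(1)] zero3'[OF ETr[OF ET(2)] Et that T4]
      zero3'[OF ETr[OF ET(3)] Et that T5] by auto
  \<comment> \<open>Symmetry of \<open>Et\<close> allows the same exchange for the left
    factor.\<close>
  have flip: "transpose_mat S * Et * X = transpose_mat T * Et * X"
    if "Et * S = Et * T" "S \<in> carrier_mat n k" "T \<in> carrier_mat n k" for S T X k
  proof -
    have "transpose_mat (Et * S) = transpose_mat (Et * T)" using that(1) by simp
    then show ?thesis using transpose_mult[OF Et that(2)] transpose_mult[OF Et that(3)] sym by simp
  qed
  have Eblocks: "transpose_mat S1 * Et * V1 = transpose_mat T1 * Et * T1"
    "transpose_mat S2 * Et * V2 = transpose_mat T2 * Et * T2"
    "transpose_mat S1 * Et * V2 = 0\<^sub>m n1 n2" "transpose_mat S2 * Et * V1 = 0\<^sub>m n2 n1"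
    using flip[OF S1(2,1) T1] flip[OF S2(2,1) T2] cong[OF V1(2) Et T1 V1(1) T1] cong[OF V2(2) Et T2 V2(1) T2]
      cong[OF V1(2) Et T2 V1(1) T1] cong[OF V2(2) Et T1 V2(1) T2] E12 E21 by auto
  have eqE: "S * E * T = block_mat
          [[transpose_mat T1 * Et * T1, 0\<^sub>m n1 n2, 0\<^sub>m n1 n3, 0\<^sub>m n1 n4, 0\<^sub>m n1 n5],
           [0\<^sub>m n2 n1, transpose_mat T2 * Et * T2, 0\<^sub>m n2 n3, 0\<^sub>m n2 n4, 0\<^sub>m n2 n5],
           [0\<^sub>m n3 n1, 0\<^sub>m n3 n2, 0\<^sub>m n3 n3, 0\<^sub>m n3 n4, 0\<^sub>m n3 n5],
           [0\<^sub>m n4 n1, 0\<^sub>m n4 n2, 0\<^sub>m n4 n3, 0\<^sub>m n4 n4, 0\<^sub>m n4 n5],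
           [0\<^sub>m n5 n1, 0\<^sub>m n5 n2, 0\<^sub>m n5 n3, 0\<^sub>m n5 n4, 0\<^sub>m n5 n5]]"
    unfolding SE unfolding L_def T_def block_mat_hcat_mats[OF list.distinct(2) Lrows list.distinct(2) Trows Et]
    by (simp only: list.map Eblocks Zr[OF S1(1)] Zr[OF S2(1)] Zr[OF S3(1)] Zr[OF T4] Zr[OF T5]
        Zr[OF V1(1)] Zr[OF V2(1)] Zr[OF V3(1)])
  have Ablocks: "transpose_mat S1 * At * T4 = 0\<^sub>m n1 n4" "transpose_mat S2 * At * T4 = 0\<^sub>m n2 n4"
    "transpose_mat S3 * At * T4 = 0\<^sub>m n3 n4"
    using transpose_triple_zero_iff[OF S1(1) At T4] transpose_triple_zero_iff[OF S2(1) At T4]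
      transpose_triple_zero_iff[OF S3(1) At T4] S1(4) S2(4) S3(4) by auto
  have eqA: "S * A * T = block_mat
          [[transpose_mat S1 * At * V1, transpose_mat S1 * At * V2, transpose_mat S1 * At * V3,
            0\<^sub>m n1 n4, transpose_mat S1 * At * T5],
           [transpose_mat S2 * At * V1, transpose_mat S2 * At * V2, transpose_mat S2 * At * V3,
            0\<^sub>m n2 n4, transpose_mat S2 * At * T5],
           [transpose_mat S3 * At * V1, transpose_mat S3 * At * V2, transpose_mat S3 * At * V3,
            0\<^sub>m n3 n4, transpose_mat S3 * At * T5],
           [0\<^sub>m n4 n1, 0\<^sub>m n4 n2, 0\<^sub>m n4 n3, transpose_mat T4 * At * T4, 0\<^sub>m n4 n5],
           [transpose_mat T5 * At * V1, transpose_mat T5 * At * V2, transpose_mat T5 * At * V3,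
            0\<^sub>m n5 n4, 0\<^sub>m n5 n5]]"
    unfolding SA unfolding L_def T_def block_mat_hcat_mats[OF list.distinct(2) Lrows list.distinct(2) Trows At]
    by (simp only: list.map Ablocks V1(4) V2(4) V3(4) A45 A54 A55)
  \<comment> \<open>Stated for arbitrary blocks with the outputs of \<open>T1\<close>,
    \<open>T2\<close>, \<open>T3\<close>: the \<open>V\<close> blocks give the blocks of
    \<open>C\<close>, and the \<open>S\<close> blocks, after transposition, those of
    \<open>B\<close>.\<close>
  have Cblocks: "transpose_mat W1 * C * X1 = transpose_mat W1 * C * T1"
    "transpose_mat W1 * C * X2 = 0\<^sub>m n1 n2" "transpose_mat W1 * C * X3 = 0\<^sub>m n1 n3"
    "transpose_mat W2 * C * X1 = 0\<^sub>m m1 n1" "transpose_mat W2 * C * X2 = 0\<^sub>m m1 n2" "transpose_mat W2 * C * X3 = 0\<^sub>m m1 n3"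
    "transpose_mat W3 * C * X1 = 0\<^sub>m n3 n1" "transpose_mat W3 * C * X2 = 0\<^sub>m n3 n2"
    "transpose_mat W3 * C * X3 = transpose_mat W3 * C * T3"
    if "X1 \<in> carrier_mat n n1" "C * X1 = C * T1" "X2 \<in> carrier_mat n n2" "C * X2 = C * T2"
      "X3 \<in> carrier_mat n n3" "C * X3 = C * T3" for X1 X2 X3
    by (simp_all only: cong[OF that(2) C W1 that(1) T1] cong[OF that(2) C W2 that(1) T1] cong[OF that(2) C W3 that(1) T1]
        cong[OF that(4) C W1 that(3) T2] cong[OF that(4) C W2 that(3) T2] cong[OF that(4) C W3 that(3) T2]
        cong[OF that(6) C W1 that(5) T3] cong[OF that(6) C W2 that(5) T3] cong[OF that(6) C W3 that(5) T3]
        C21 C31 C12 C22 C32 C13 C23)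
  note CV = Cblocks[OF V1(1,3) V2(1,3) V3(1,3)] and CS = Cblocks[OF S1(1,3) S2(1,3) S3(1,3)]
  have C45: "transpose_mat Y * C * T4 = 0\<^sub>m l n4" "transpose_mat Y * C * T5 = 0\<^sub>m l n5"
    if "Y \<in> carrier_mat m l" for Y l
    using zero3[OF CT4 C that T4] zero3[OF CT5 C that T5] by auto
  have eqC: "transpose_mat W * C * T = block_mat
          [[transpose_mat W1 * C * T1, 0\<^sub>m n1 n2, 0\<^sub>m n1 n3, 0\<^sub>m n1 n4, 0\<^sub>m n1 n5],
           [0\<^sub>m m1 n1, 0\<^sub>m m1 n2, 0\<^sub>m m1 n3, 0\<^sub>m m1 n4, 0\<^sub>m m1 n5],
           [0\<^sub>m n3 n1, 0\<^sub>m n3 n2, transpose_mat W3 * C * T3, 0\<^sub>m n3 n4, 0\<^sub>m n3 n5]]"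
    unfolding W_def T_def block_mat_hcat_mats[OF list.distinct(2) Wrows list.distinct(2) Trows C]
    by (simp only: list.map CV C45[OF W1] C45[OF W2] C45[OF W3])
  have Btr: "transpose_mat X * transpose_mat C * Y = transpose_mat (transpose_mat Y * C * X)"
    if "X \<in> carrier_mat n k" "Y \<in> carrier_mat m l" for X Y k l
    using transpose_mult3[OF that(2) C that(1)] by simp
  note BS1 = Btr[OF S1(1)] and BS2 = Btr[OF S2(1)] and BS3 = Btr[OF S3(1)] and BT4 = Btr[OF T4] and BT5 = Btr[OF T5]
  have eqB: "S * B * W = block_mat
          [[transpose_mat (transpose_mat W1 * C * T1), 0\<^sub>m n1 m1, 0\<^sub>m n1 n3],
           [0\<^sub>m n2 n1, 0\<^sub>m n2 m1, 0\<^sub>m n2 n3],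
           [0\<^sub>m n3 n1, 0\<^sub>m n3 m1, transpose_mat (transpose_mat W3 * C * T3)],
           [0\<^sub>m n4 n1, 0\<^sub>m n4 m1, 0\<^sub>m n4 n3],
           [0\<^sub>m n5 n1, 0\<^sub>m n5 m1, 0\<^sub>m n5 n3]]"
    unfolding SB unfolding L_def W_def block_mat_hcat_mats[OF list.distinct(2) Lrows list.distinct(2) Wrows CT]
    by (simp only: list.map BS1[OF W1] BS1[OF W2] BS1[OF W3] BS2[OF W1] BS2[OF W2] BS2[OF W3]
        BS3[OF W1] BS3[OF W2] BS3[OF W3] BT4[OF W1] BT4[OF W2] BT4[OF W3] BT5[OF W1] BT5[OF W2] BT5[OF W3]
        CS C45[OF W1] C45[OF W2] C45[OF W3] zero_transpose_mat)
  have carr: "transpose_mat X * M * Y \<in> carrier_mat k l"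
    if "X \<in> carrier_mat p k" "M \<in> carrier_mat p q" "Y \<in> carrier_mat q l" for X M Y :: "real mat" and p q k l
    using that by simp
  note c11 = carr[OF W1 C T1] and c33 = carr[OF W3 C T3]
  have b11: "transpose_mat (transpose_mat W1 * C * T1) \<in> carrier_mat n1 n1"
    and b33: "transpose_mat (transpose_mat W3 * C * T3) \<in> carrier_mat n3 n3"
    using c11 c33 by auto
  note ranks = inj_mat_rank[OF E11 carr[OF T1 Et T1]]
    inj_mat_rank[OF inj_mat_transpose[OF C11 c11] b11] inj_mat_rank[OF C11 c11]
    inj_mat_rank[OF E22 carr[OF T2 Et T2]]
    inj_mat_rank[OF inj_mat_transpose[OF C33 c33] b33] inj_mat_rank[OF C33 c33]
    inj_mat_rank[OF A44 carr[OF T4 At T4]]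
  note carrA = carr[OF S1(1) At] carr[OF S2(1) At] carr[OF S3(1) At] carr[OF T5 At]
  \<comment> \<open>The 22 block witnesses are left open and fixed by unification with the carrier
    facts, which therefore follow the order of the conjuncts.\<close>
  show ?thesis unfolding has_condensed_form_def
    by (rule exI[of _ n1], rule exI[of _ n2], rule exI[of _ n3], rule exI[of _ n4], rule exI[of _ n5], rule exI[of _ m1],
        rule exI[of _ S], rule exI[of _ T], rule exI[of _ W],
        rule exI, rule exI, rule exI, rule exI, rule exI, rule exI, rule exI, rule exI, rule exI, rule exI, rule exI,
        rule exI, rule exI, rule exI, rule exI, rule exI, rule exI, rule exI, rule exI, rule exI, rule exI, rule exI,
        intro conjI, rule dims(1), rule dims(2), rule S, rule invS, rule T, rule invT, rule W, rule orthW,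
        rule carr[OF T1 Et T1], rule carr[OF T2 Et T2], rule b11, rule b33,
        rule carrA(1)[OF V1(1)], rule carrA(1)[OF V2(1)], rule carrA(1)[OF V3(1)], rule carrA(1)[OF T5],
        rule carrA(2)[OF V1(1)], rule carrA(2)[OF V2(1)], rule carrA(2)[OF V3(1)], rule carrA(2)[OF T5],
        rule carrA(3)[OF V1(1)], rule carrA(3)[OF V2(1)], rule carrA(3)[OF V3(1)], rule carrA(3)[OF T5],
        rule carr[OF T4 At T4],
        rule carrA(4)[OF V1(1)], rule carrA(4)[OF V2(1)], rule carrA(4)[OF V3(1)],
        rule c11, rule c33, rule eqE, rule eqB, rule eqA, rule eqC,
        rule ranks(1), rule ranks(2), rule ranks(3), rule ranks(4), rule ranks(5), rule ranks(6), rule ranks(7))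
qed

section \<open>Port-Hamiltonian systems\<close>

lemma skew_form_zero:
  fixes M :: "real mat"
  assumes M: "M \<in> carrier_mat n n" and skew: "M = - transpose_mat M" and x: "x \<in> carrier_vec n"
  shows "x \<bullet> (M *\<^sub>v x) = 0"
proof -
  have Mx: "transpose_mat M *\<^sub>v x \<in> carrier_vec n" using M x by simp
  have Mx_eq: "M *\<^sub>v x = - (transpose_mat M *\<^sub>v x)"
    by (subst skew) (use M x in simp)
  have dim: "dim_vec x = dim_vec (transpose_mat M *\<^sub>v x)"
    unfolding carrier_vecD[OF Mx] carrier_vecD[OF x] ..
  have "x \<bullet> (M *\<^sub>v x) = - (x \<bullet> (transpose_mat M *\<^sub>v x))"
    unfolding Mx_eq scalar_prod_uminus_right[OF dim] ..
  also have "x \<bullet> (transpose_mat M *\<^sub>v x) = x \<bullet> (M *\<^sub>v x)"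
    using comm_scalar_prod[OF x Mx] transpose_vec_mult_scalar[OF M x x] by simp
  finally show ?thesis by simp
qed

text \<open>Nonsingularity of \<open>Q\<close> turns \<open>transpose_mat Q * P = 0\<close> into
  \<open>P = 0\<close>, so \<open>B = G\<close> and the transpose of \<open>C\<close> is
  \<open>transpose_mat Q * B\<close>. In the form of \<open>transpose_mat Q * A\<close> the skew
  \<open>J\<close> part drops out and the semidefinite \<open>R\<close> part enters with a minus
  sign.\<close>

lemma pH_representation_invertible:
  assumes E: "E \<in> carrier_mat n n"
    and pH: "pH_representation n m E A B C J R Q G P" and inv: "invertible_mat Q"
  shows "Q \<in> carrier_mat n n" "inj_mat (transpose_mat Q)" "transpose_mat C = transpose_mat Q * B"
    "transpose_mat (transpose_mat Q * E) = transpose_mat Q * E"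
    "x \<in> carrier_vec n \<Longrightarrow> 0 \<le> x \<bullet> (transpose_mat Q * E *\<^sub>v x)"
    "x \<in> carrier_vec n \<Longrightarrow> x \<bullet> (transpose_mat Q * A *\<^sub>v x) \<le> 0"
proof -
  have J: "J \<in> carrier_mat n n" and R: "R \<in> carrier_mat n n" and Q: "Q \<in> carrier_mat n n"
    and G: "G \<in> carrier_mat n m" and P: "P \<in> carrier_mat n m"
    and A: "A = (J - R) * Q" and B: "B = G - P" and C: "C = transpose_mat (G + P) * Q"
    and psdE: "psd_mat (transpose_mat Q * E)"
    and skew: "transpose_mat Q * J * Q = - transpose_mat (transpose_mat Q * J * Q)"
    and psdR: "psd_mat (transpose_mat Q * R * Q)" and QP: "transpose_mat Q * P = 0\<^sub>m n m"
    using pH unfolding pH_representation_def by blast+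
  show "Q \<in> carrier_mat n n" by fact
  have QT: "transpose_mat Q \<in> carrier_mat n n" using Q by simp
  obtain N where QN: "Q * N = 1\<^sub>m n" and NQ: "N * Q = 1\<^sub>m (dim_row N)"
    using inv Q unfolding invertible_mat_def inverts_mat_def by auto
  \<comment> \<open>\<open>invertible_mat\<close> leaves the size of the inverse open; comparing
    column counts in both identities determines it.\<close>
  have N: "N \<in> carrier_mat n n"
    using arg_cong[OF QN, of dim_col] arg_cong[OF NQ, of dim_col] Q by (intro carrier_matI) auto
  have NT: "transpose_mat N \<in> carrier_mat n n" using N by simp
  have NQT: "transpose_mat N * transpose_mat Q = 1\<^sub>m n"
    using transpose_mult[OF Q N] QN by simp
  show "inj_mat (transpose_mat Q)"
    by (rule inj_mat_mult_right[OF _ NT QT]) (simp add: NQT inj_mat_one)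
  have "P = transpose_mat N * (transpose_mat Q * P)"
    using assoc_mult_mat[OF NT QT P] NQT P by simp
  then have P0: "P = 0\<^sub>m n m" using QP NT by simp
  have "G + P = G" "B = G" unfolding B P0 using G by auto
  then show "transpose_mat C = transpose_mat Q * B"
    using C transpose_mult[of "transpose_mat G" m n Q n] G Q by simp
  show "transpose_mat (transpose_mat Q * E) = transpose_mat Q * E"
    "x \<in> carrier_vec n \<Longrightarrow> 0 \<le> x \<bullet> (transpose_mat Q * E *\<^sub>v x)"
    using psdE Q unfolding psd_mat_def by auto
  assume x: "x \<in> carrier_vec n"
  define MJ MR where "MJ = transpose_mat Q * J * Q" and "MR = transpose_mat Q * R * Q"
  have MJ: "MJ \<in> carrier_mat n n" and MR: "MR \<in> carrier_mat n n"
    using Q J R by (auto simp: MJ_def MR_def)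
  have "transpose_mat Q * A = transpose_mat Q * (J * Q - R * Q)"
    unfolding A using minus_mult_distrib_mat[OF J R Q] by simp
  also have "\<dots> = MJ - MR"
    unfolding MJ_def MR_def assoc_mult_mat[OF QT J Q] assoc_mult_mat[OF QT R Q]
    using mult_minus_distrib_mat[OF QT mult_carrier_mat[OF J Q] mult_carrier_mat[OF R Q]] .
  finally have QA: "transpose_mat Q * A = MJ - MR" .
  have "x \<bullet> (transpose_mat Q * A *\<^sub>v x) = x \<bullet> (MJ *\<^sub>v x) - x \<bullet> (MR *\<^sub>v x)"
    unfolding QA minus_mult_distrib_mat_vec[OF MJ MR x]
    using scalar_prod_minus_distrib[OF x mult_mat_vec_carrier[OF MJ x] mult_mat_vec_carrier[OF MR x]] .
  moreover have "x \<bullet> (MJ *\<^sub>v x) = 0"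
    using skew_form_zero[OF MJ _ x] skew by (simp add: MJ_def)
  moreover have "0 \<le> x \<bullet> (MR *\<^sub>v x)"
    using psdR x MR unfolding psd_mat_def MR_def[symmetric] by auto
  ultimately show "x \<bullet> (transpose_mat Q * A *\<^sub>v x) \<le> 0" by simp
qed

theorem lemma4p2:
  fixes n m :: nat and E A B C J R Q G P :: "real mat"
  assumes "E \<in> carrier_mat n n" and "A \<in> carrier_mat n n"
    and "B \<in> carrier_mat n m" and "C \<in> carrier_mat m n"
    and "pH_representation n m E A B C J R Q G P"
    and "invertible_mat Q"
  shows
    "\<exists>(n1::nat) (n2::nat) (n3::nat) (n4::nat) (n5::nat) (m1::nat) S T W
         E11 E22 B11 B33 A11 A12 A13 A15
         A21 A22 A23 A25 A31 A32 A33 A35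
         A44 A51 A52 A53 C11 C33.
      n1 + n2 + n3 + n4 + n5 = n \<and> n1 + m1 + n3 = m \<and>
      S \<in> carrier_mat n n \<and> invertible_mat S \<and>
      T \<in> carrier_mat n n \<and> invertible_mat T \<and>
      W \<in> carrier_mat m m \<and> real_orthogonal_mat W \<and>
      E11 \<in> carrier_mat n1 n1 \<and> E22 \<in> carrier_mat n2 n2 \<and> B11 \<in> carrier_mat n1 n1 \<and>
      B33 \<in> carrier_mat n3 n3 \<and> A11 \<in> carrier_mat n1 n1 \<and> A12 \<in> carrier_mat n1 n2 \<and>
      A13 \<in> carrier_mat n1 n3 \<and> A15 \<in> carrier_mat n1 n5 \<and> A21 \<in> carrier_mat n2 n1 \<and>
      A22 \<in> carrier_mat n2 n2 \<and> A23 \<in> carrier_mat n2 n3 \<and> A25 \<in> carrier_mat n2 n5 \<and>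
      A31 \<in> carrier_mat n3 n1 \<and> A32 \<in> carrier_mat n3 n2 \<and> A33 \<in> carrier_mat n3 n3 \<and>
      A35 \<in> carrier_mat n3 n5 \<and> A44 \<in> carrier_mat n4 n4 \<and> A51 \<in> carrier_mat n5 n1 \<and>
      A52 \<in> carrier_mat n5 n2 \<and> A53 \<in> carrier_mat n5 n3 \<and> C11 \<in> carrier_mat n1 n1 \<and>
      C33 \<in> carrier_mat n3 n3 \<and>
      S * E * T = block_mat
          [[E11, 0\<^sub>m n1 n2, 0\<^sub>m n1 n3, 0\<^sub>m n1 n4, 0\<^sub>m n1 n5],
           [0\<^sub>m n2 n1, E22, 0\<^sub>m n2 n3, 0\<^sub>m n2 n4, 0\<^sub>m n2 n5],
           [0\<^sub>m n3 n1, 0\<^sub>m n3 n2, 0\<^sub>m n3 n3, 0\<^sub>m n3 n4, 0\<^sub>m n3 n5],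
           [0\<^sub>m n4 n1, 0\<^sub>m n4 n2, 0\<^sub>m n4 n3, 0\<^sub>m n4 n4, 0\<^sub>m n4 n5],
           [0\<^sub>m n5 n1, 0\<^sub>m n5 n2, 0\<^sub>m n5 n3, 0\<^sub>m n5 n4, 0\<^sub>m n5 n5]] \<and>
      S * B * W = block_mat
          [[B11, 0\<^sub>m n1 m1, 0\<^sub>m n1 n3],
           [0\<^sub>m n2 n1, 0\<^sub>m n2 m1, 0\<^sub>m n2 n3],
           [0\<^sub>m n3 n1, 0\<^sub>m n3 m1, B33],
           [0\<^sub>m n4 n1, 0\<^sub>m n4 m1, 0\<^sub>m n4 n3],
           [0\<^sub>m n5 n1, 0\<^sub>m n5 m1, 0\<^sub>m n5 n3]] \<and>
      S * A * T = block_mat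
          [[A11, A12, A13, 0\<^sub>m n1 n4, A15],
           [A21, A22, A23, 0\<^sub>m n2 n4, A25],
           [A31, A32, A33, 0\<^sub>m n3 n4, A35],
           [0\<^sub>m n4 n1, 0\<^sub>m n4 n2, 0\<^sub>m n4 n3, A44, 0\<^sub>m n4 n5],
           [A51, A52, A53, 0\<^sub>m n5 n4, 0\<^sub>m n5 n5]] \<and>
      transpose_mat W * C * T = block_mat
          [[C11, 0\<^sub>m n1 n2, 0\<^sub>m n1 n3, 0\<^sub>m n1 n4, 0\<^sub>m n1 n5],
           [0\<^sub>m m1 n1, 0\<^sub>m m1 n2, 0\<^sub>m m1 n3, 0\<^sub>m m1 n4, 0\<^sub>m m1 n5],
           [0\<^sub>m n3 n1, 0\<^sub>m n3 n2, C33, 0\<^sub>m n3 n4, 0\<^sub>m n3 n5]] \<and>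
      mat_rank E11 = n1 \<and> mat_rank B11 = n1 \<and> mat_rank C11 = n1 \<and>
      mat_rank E22 = n2 \<and> mat_rank B33 = n3 \<and> mat_rank C33 = n3 \<and>
      mat_rank A44 = n4"
proof -
  note pH = pH_representation_invertible[OF assms(1,5,6)]
  have "has_condensed_form n m E A B C"
    using dissipative_has_condensed_form[OF assms(1-4) pH] .
  then show ?thesis unfolding has_condensed_form_def .
qed

end
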